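(* Let $U \in \mathrm{St}(n,p)$ and $\Delta = UA+U_\perp B \in T_U\mathrm{St}(n,p)$, with $A\in\mathfrak{so}(p)$, $B\in\mathbb{R}^{(n-p)\times p}$, and with compact SVD $(I_n-UU^T)\Delta = U_\perp B = Q\Sigma V^T$. The mapping $\mathcal{RS} \colon T\mathrm{St}(n,p)\to \mathrm{St}(n,p)$ defined by $$\mathcal{RS}_U(\Delta) := (UV\cos(\Sigma) + Q\sin(\Sigma))V^T\exp_m(A)$$ is a retraction, with corresponding quasi-geodesic $$\gamma(t) = \mathcal{RS}_U(t\Delta)=(UV\cos(t\Sigma) + Q\sin(t\Sigma))V^T\exp_m(tA).$$ An orthogonal completion of $\gamma(t)$ is $$\gamma_\perp(t)=\begin{pmatrix} U & U_\perp \end{pmatrix}\exp_m\left(t \begin{pmatrix} 0 & -B^T\\ B & 0 \end{pmatrix}\right) \begin{pmatrix}0\\ I_{n-p}\end{pmatrix}.$$ The quasi-geodesic $\gamma$ has the following properties: 1. $\gamma(0) = U$; 2. $\dot\gamma(t) =\gamma(t)A+\gamma_\perp(t)B\exp_m(tA)$; 3. $\|\dot\gamma(t)\|^2=\frac{1}{2}\operatorname{tr}(A^TA) + \operatorname{tr}(B^TB)$ (constant speed); 4. $\ddot\gamma(t) = \gamma(t)\left(A^2-\exp_m(tA^T)B^TB\exp_m(tA)\right) + 2\gamma_\perp(t)BA\exp_m(tA)$; 5. $D_t\dot\gamma(t) = \gamma_\perp(t)BA\exp_m(tA)$; 6. $\|D_t\dot\gamma(t)\|^2 = \|BA\|_F^2$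 (constant-norm covariant acceleration). Furthermore, $\gamma$ is a geodesic if and only if $BA=0$.
   Context: The Stiefel manifold is $\mathrm{St}(n,p) = \{U \in \mathbb{R}^{n \times p} : U^TU=I_p\}$. Its tangent space at $U$ is $T_U\mathrm{St}(n,p) = \{UA+U_\perp B : A \in \mathfrak{so}(p),\ B \in \mathbb{R}^{(n-p)\times p}\}$, where $\mathfrak{so}(p)$ denotes the real skew-symmetric $p\times p$ matrices and $U_\perp\in\mathbb{R}^{n\times(n-p)}$ is an arbitrary but fixed orthonormal completion of $U$, i.e. $\begin{pmatrix} U & U_\perp\end{pmatrix}\in \mathrm{O}(n)$ (an orthogonal completion of a point of $\mathrm{St}(n,p)$ is any such $U_\perp$). $\mathrm{St}(n,p)$ carries the Riemannian metric given by the canonical inner product $g_U(\Delta_1,\Delta_2)=\operatorname{tr}\left(\Delta_1^T(I_n-\frac12 UU^T)\Delta_2\right)$; for tangent vectors, $\|\cdot\|$ denotes the norm induced by $g$ at the foot point, geodesics are those of $g$, and $\|\cdot\|_F$ is the Frobenius norm. $\exp_m$ is the matrix exponential. The compact SVD of the $n\times p$ matrix $(I_n-UU^T)\Delta$ is $Q\Sigma V^T$ with $Q\in\mathrm{St}(n,p)$, $\Sigma\in\mathbb{R}^{p\times p}$ diagonal with nonnegative entries, $V\in\mathrm{O}(p)$; $\cos$ and $\sin$ of a diagonal matrix are taken entrywise on the diagonal. $D_t$ is the covariant derivative along the curve with respect to the Levi-Civita connection of $g$. For a smooth curve $\gamma$ in $\mathrm{St}(n,p)$ it is given by the known formula $D_t\dot\gamma=\ddot\gamma+\dot\gamma\dot\gamma^T\gamma+\gamma\left((\gamma^T\dot\gamma)^2+\dot\gamma^T\dot\gamma\right)$.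 A retraction on a smooth manifold $M$ is a smooth mapping $R\colon TM\to M$ such that, writing $R_x$ for the restriction of $R$ to $T_xM$: (1) $R_x(0)=x$ for all $x\in M$; (2) the derivative $\mathrm{d}R_x(0)$ is the identity mapping on $T_0T_xM\simeq T_xM$. A quasi-geodesic is a smooth curve with constant speed $\|\dot\gamma(t)\|$ and covariant acceleration $D_t\dot\gamma(t)$ of constant (possibly non-zero) norm. *)

theory Defs
  imports "HOL-Analysis.Analysis"
begin

section \<open>Matrices\<close>

text \<open>
  An \<open>n \<times> p\<close> matrix is an element of \<open>real ^ 'p ^ 'n\<close>, and \<open>norm\<close> on this type is the Frobenius
  norm. HOL types are nonempty, so a matrix with \<open>k\<close> columns (or rows) where \<open>k = 0\<close> is allowed
  is encoded by an index type \<open>'m\<close> together with a set \<open>J :: 'm set\<close> of \<open>k\<close> indices: all entries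
  outside \<open>J\<close> are zero, and the identity matrix of size \<open>k\<close> is \<open>mat_on J\<close>. For
  \<open>J = UNIV\<close> this is the usual type-indexed representation; \<open>J = {}\<close> covers the empty matrix.
\<close>

definition cols_on :: "'m set \<Rightarrow> (real ^ 'm ^ 'n) set" where
  "cols_on J = {W. \<forall>i j. j \<notin> J \<longrightarrow> W $ i $ j = 0}"

definition rows_on :: "'m set \<Rightarrow> (real ^ 'p ^ 'm) set" where
  "rows_on J = {B. \<forall>i j. i \<notin> J \<longrightarrow> B $ i $ j = 0}"

definition mat_on :: "'m set \<Rightarrow> real ^ 'm ^ 'm" where
  "mat_on J = (\<chi> i j. if i = j \<and> i \<in> J then 1 else 0)"

definition hcat :: "real ^ 'p ^ 'n \<Rightarrow> real ^ 'm ^ 'n \<Rightarrow> real ^ ('p + 'm) ^ 'n" where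
  "hcat X Y = (\<chi> i j. case j of Inl a \<Rightarrow> X $ i $ a | Inr b \<Rightarrow> Y $ i $ b)"

definition vcat :: "real ^ 'k ^ 'p \<Rightarrow> real ^ 'k ^ 'm \<Rightarrow> real ^ 'k ^ ('p + 'm)" where
  "vcat X Y = (\<chi> i j. case i of Inl a \<Rightarrow> X $ a $ j | Inr b \<Rightarrow> Y $ b $ j)"

primrec mat_pow :: "real ^ 'p ^ 'p \<Rightarrow> nat \<Rightarrow> real ^ 'p ^ 'p" where
  "mat_pow A 0 = mat 1"
| "mat_pow A (Suc k) = A ** mat_pow A k"

text \<open>The library function \<open>exp\<close> is not available here: multiplication on \<open>vec\<close> is componentwise.\<close>

definition mat_exp :: "real ^ 'p ^ 'p \<Rightarrow> real ^ 'p ^ 'p" where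
  "mat_exp A = (\<Sum>k. (1 / fact k) *\<^sub>R mat_pow A k)"

definition skew :: "real ^ 'p ^ 'p \<Rightarrow> bool" where
  "skew A \<longleftrightarrow> transpose A = - A"

definition diagonal_mat :: "real ^ 'p ^ 'p \<Rightarrow> bool" where
  "diagonal_mat S \<longleftrightarrow> (\<forall>i j. i \<noteq> j \<longrightarrow> S $ i $ j = 0)"

definition diag_map :: "(real \<Rightarrow> real) \<Rightarrow> real ^ 'p ^ 'p \<Rightarrow> real ^ 'p ^ 'p" where
  "diag_map f S = (\<chi> i j. if i = j then f (S $ i $ i) else 0)"


section \<open>Smoothness\<close>

text \<open>
  On an open set \<open>S\<close>, \<open>C_diff_on k S f\<close> says that \<open>f\<close> is of class \<open>C\<^sup>k\<close>. The iterated derivatives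
  are taken direction by direction because the type of the full higher derivative depends on \<open>k\<close>.
\<close>

primrec C_diff_on :: "nat \<Rightarrow> 'a::euclidean_space set \<Rightarrow> ('a \<Rightarrow> 'b::real_normed_vector) \<Rightarrow> bool" where
  "C_diff_on 0 S f \<longleftrightarrow> continuous_on S f"
| "C_diff_on (Suc k) S f \<longleftrightarrow> (\<forall>x\<in>S. f differentiable at x) \<and>
     (\<forall>v. C_diff_on k S (\<lambda>x. frechet_derivative f (at x) v))"

text \<open>
  Smoothness on an arbitrary subset of a Euclidean space: local existence of smooth extensions.
  On an embedded submanifold this is smoothness with respect to the submanifold structure, and on
  an open set it is ordinary smoothness.
\<close>

definition smooth_on :: "'a::euclidean_space set \<Rightarrow> ('a \<Rightarrow> 'b::real_normed_vector) \<Rightarrow> bool" where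
  "smooth_on S f \<longleftrightarrow> (\<forall>x\<in>S. \<exists>N h. open N \<and> x \<in> N \<and> (\<forall>k. C_diff_on k N h) \<and>
     (\<forall>y \<in> S \<inter> N. h y = f y))"


section \<open>Embedded submanifolds with a Riemannian metric\<close>

text \<open>
  In this section \<open>M\<close> is an embedded submanifold of a Euclidean space with tangent spaces \<open>T x\<close>,
  and \<open>g x\<close>, for \<open>x\<close> in a neighbourhood of \<open>M\<close>, is a symmetric bilinear form depending smoothly
  on \<open>x\<close> whose restriction to \<open>T x\<close> is the Riemannian metric.
\<close>

definition tangent_bundle :: "'a set \<Rightarrow> ('a \<Rightarrow> 'a set) \<Rightarrow> ('a \<times> 'a) set" where
  "tangent_bundle M T = {(x, v). x \<in> M \<and> v \<in> T x}"

definition is_retraction ::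
    "'a::euclidean_space set \<Rightarrow> ('a \<Rightarrow> 'a set) \<Rightarrow> ('a \<Rightarrow> 'a \<Rightarrow> 'a) \<Rightarrow> bool" where
  "is_retraction M T R \<longleftrightarrow>
     (\<forall>x\<in>M. \<forall>v\<in>T x. R x v \<in> M) \<and>
     smooth_on (tangent_bundle M T) (\<lambda>(x, v). R x v) \<and>
     (\<forall>x\<in>M. R x 0 = x) \<and>
     (\<forall>x\<in>M. (R x has_derivative (\<lambda>v. v)) (at 0 within T x))"

definition metric_norm :: "('a \<Rightarrow> 'a \<Rightarrow> 'a \<Rightarrow> real) \<Rightarrow> 'a \<Rightarrow> 'a \<Rightarrow> real" where
  "metric_norm g x v = sqrt (g x v v)"

abbreviation velocity :: "(real \<Rightarrow> 'a::real_normed_vector) \<Rightarrow> real \<Rightarrow> 'a" where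
  "velocity c t \<equiv> vector_derivative c (at t)"

text \<open>
  The covariant derivative of the velocity of \<open>c\<close> for the Levi-Civita connection of the
  submanifold. This is the Koszul formula in ambient coordinates: with \<open>x = c t\<close>,
  \<open>v = c' t\<close>, \<open>a = c'' t\<close>, the tangent vector \<open>D\<close> is determined by
  \<open>g\<^sub>x(D, w) = g\<^sub>x(a, w) + (\<partial>\<^sub>v g)(v, w) - (\<partial>\<^sub>w g)(v, v) / 2\<close> for all tangent \<open>w\<close>, the last two
  terms being the Christoffel symbols of the first kind contracted with \<open>v\<close>, \<open>v\<close>, \<open>w\<close>.
  For the Stiefel manifold it is evaluated in \<open>stiefel_covariant_acceleration\<close> below.
\<close>

definition covariant_acceleration ::
    "('a::euclidean_space \<Rightarrow> 'a set) \<Rightarrow> ('a \<Rightarrow> 'a \<Rightarrow> 'a \<Rightarrow> real) \<Rightarrow> (real \<Rightarrow> 'a) \<Rightarrow> real \<Rightarrow> 'a" where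
  "covariant_acceleration T g c t =
     (let x = c t; v = velocity c t; a = velocity (velocity c) t in
       (THE D. D \<in> T x \<and>
          (\<forall>w\<in>T x. g x D w = g x a w + frechet_derivative (\<lambda>y. g y v w) (at x) v
             - frechet_derivative (\<lambda>y. g y v v) (at x) w / 2)))"

definition is_smooth_curve :: "'a::euclidean_space set \<Rightarrow> (real \<Rightarrow> 'a) \<Rightarrow> bool" where
  "is_smooth_curve M c \<longleftrightarrow> smooth_on UNIV c \<and> range c \<subseteq> M"

definition is_geodesic :: "'a::euclidean_space set \<Rightarrow> ('a \<Rightarrow> 'a set) \<Rightarrow> ('a \<Rightarrow> 'a \<Rightarrow> 'a \<Rightarrow> real) \<Rightarrow>
    (real \<Rightarrow> 'a) \<Rightarrow> bool" where
  "is_geodesic M T g c \<longleftrightarrow> is_smooth_curve M c \<and> (\<forall>t. covariant_acceleration T g c t = 0)"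

definition is_quasi_geodesic :: "'a::euclidean_space set \<Rightarrow> ('a \<Rightarrow> 'a set) \<Rightarrow>
    ('a \<Rightarrow> 'a \<Rightarrow> 'a \<Rightarrow> real) \<Rightarrow> (real \<Rightarrow> 'a) \<Rightarrow> bool" where
  "is_quasi_geodesic M T g c \<longleftrightarrow> is_smooth_curve M c \<and>
     (\<exists>r. \<forall>t. metric_norm g (c t) (velocity c t) = r) \<and>
     (\<exists>r. \<forall>t. metric_norm g (c t) (covariant_acceleration T g c t) = r)"


section \<open>The Stiefel manifold\<close>

definition stiefel :: "(real ^ 'p ^ 'n) set" where
  "stiefel = {U. transpose U ** U = mat 1}"

text \<open>
  \<open>(U W)\<close> is orthogonal; its column index set is \<open>UNIV <+> J\<close>. Both equations are needed because
  squareness is not visible in the type.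
\<close>

definition orth_completion :: "'m::finite set \<Rightarrow> real ^ 'p ^ 'n \<Rightarrow> real ^ 'm ^ 'n \<Rightarrow> bool" where
  "orth_completion J U W \<longleftrightarrow> W \<in> cols_on J \<and>
     transpose (hcat U W) ** hcat U W = mat_on (UNIV <+> J) \<and>
     hcat U W ** transpose (hcat U W) = mat 1"

definition tangent_coords :: "'m::finite set \<Rightarrow> real ^ 'p ^ 'n \<Rightarrow> real ^ 'm ^ 'n \<Rightarrow>
    real ^ 'p ^ 'p \<Rightarrow> real ^ 'p ^ 'm \<Rightarrow> real ^ 'p ^ 'n \<Rightarrow> bool" where
  "tangent_coords J U W A B D \<longleftrightarrow> skew A \<and> B \<in> rows_on J \<and> D = U ** A + W ** B"

text \<open>
  The tangent space does not depend on the orthogonal completion, see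
  \<open>stiefel_tangent_completion\<close> below. The index type \<open>'n\<close> is always large enough
  to hold the indices of a completion.
\<close>

definition stiefel_tangent :: "real ^ 'p ^ 'n \<Rightarrow> (real ^ 'p ^ 'n) set" where
  "stiefel_tangent U = {D. \<exists>(J :: 'n set) W A B. orth_completion J U W \<and> tangent_coords J U W A B D}"

definition stiefel_metric :: "real ^ 'p ^ 'n \<Rightarrow> real ^ 'p ^ 'n \<Rightarrow> real ^ 'p ^ 'n \<Rightarrow> real" where
  "stiefel_metric U X Y = trace (transpose X ** (mat 1 - (1/2) *\<^sub>R (U ** transpose U)) ** Y)"

definition compact_svd :: "real ^ 'p ^ 'n \<Rightarrow> real ^ 'p ^ 'n \<Rightarrow> real ^ 'p ^ 'p \<Rightarrow> real ^ 'p ^ 'p \<Rightarrow> bool"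
  where
  "compact_svd X Q S V \<longleftrightarrow> Q \<in> stiefel \<and> diagonal_mat S \<and> (\<forall>i. 0 \<le> S $ i $ i) \<and>
     orthogonal_matrix V \<and> X = Q ** S ** transpose V"

text \<open>
  The defining formula uses a representation \<open>D = U A + W B\<close> and a compact singular value decomposition,
  neither of which is unique; \<open>THE\<close> makes the independence of these choices part of every
  statement about the map.
\<close>

definition stiefel_RS :: "real ^ 'p ^ 'n \<Rightarrow> real ^ 'p ^ 'n \<Rightarrow> real ^ 'p ^ 'n" where
  "stiefel_RS U D = (THE Y. \<exists>(J :: 'n set) W A B Q S V.
     orth_completion J U W \<and> tangent_coords J U W A B D \<and>
     compact_svd ((mat 1 - U ** transpose U) ** D) Q S V \<and>
     Y = (U ** V ** diag_map cos S + Q ** diag_map sin S) ** transpose V ** mat_exp A)"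


section \<open>Consistency of the definitions\<close>

lemma inner_trace: "X \<bullet> Y = trace (transpose X ** Y)"
  for X Y :: "real ^ 'p ^ 'n"
  unfolding trace_def matrix_matrix_mult_def transpose_def inner_vec_def
  by (simp add: sum.swap [of _ "UNIV :: 'n set"])

lemma inner_matrix_left: "(X ** Y) \<bullet> Z = Y \<bullet> (transpose X ** Z)"
  for X :: "real ^ 'k ^ 'n"
  by (simp add: inner_trace matrix_transpose_mul matrix_mul_assoc)

lemma inner_transpose: "transpose X \<bullet> transpose Y = X \<bullet> Y"
  for X :: "real ^ 'p ^ 'n"
  unfolding inner_trace by (metis inner_commute inner_trace trace_mul_sym transpose_transpose)

interpretation matrix_mult: bounded_bilinear "(**) :: real ^ 'k ^ 'n \<Rightarrow> real ^ 'p ^ 'k \<Rightarrow> real ^ 'p ^ 'n"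
proof (rule bilinear_conv_bounded_bilinear [THEN iffD1])
  show "bilinear ((**) :: real ^ 'k ^ 'n \<Rightarrow> real ^ 'p ^ 'k \<Rightarrow> real ^ 'p ^ 'n)"
    unfolding bilinear_def
    by (auto intro!: linearI simp: matrix_add_ldistrib matrix_matrix_mult_def vec_eq_iff
        sum.distrib sum_distrib_left algebra_simps)
qed

lemma bounded_linear_transpose: "bounded_linear (transpose :: real ^ 'p ^ 'n \<Rightarrow> real ^ 'n ^ 'p)"
  by (rule linear_conv_bounded_linear [THEN iffD1])
    (auto intro!: linearI simp: transpose_def vec_eq_iff)

lemmas transpose_zero = linear_0 [OF bounded_linear.linear [OF bounded_linear_transpose]]
lemmas transpose_add = linear_add [OF bounded_linear.linear [OF bounded_linear_transpose]]
lemmas transpose_diff = linear_diff [OF bounded_linear.linear [OF bounded_linear_transpose]]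

lemma stiefel_metric_inner:
  "stiefel_metric U X Y = X \<bullet> Y - (transpose U ** X) \<bullet> (transpose U ** Y) / 2"
  unfolding stiefel_metric_def inner_trace
  by (simp add: matrix_mult.diff_right matrix_mult.diff_left matrix_mult.scaleR_left
      matrix_mult.scaleR_right matrix_transpose_mul matrix_mul_assoc trace_sub)
    (simp add: trace_def flip: sum_divide_distrib)

lemma orth_completion_iff:
  "orth_completion J U W \<longleftrightarrow> W \<in> cols_on J \<and> U \<in> stiefel \<and> transpose U ** W = 0 \<and>
     transpose W ** W = mat_on J \<and> U ** transpose U + W ** transpose W = mat 1"
proof -
  have 1: "transpose (hcat U W) ** hcat U W = mat_on (UNIV <+> J) \<longleftrightarrow>
      U \<in> stiefel \<and> transpose U ** W = 0 \<and> transpose W ** W = mat_on J"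
  proof -
    have "transpose (hcat U W) ** hcat U W = mat_on (UNIV <+> J) \<longleftrightarrow>
      transpose U ** U = mat 1 \<and> transpose U ** W = 0 \<and> transpose W ** U = 0 \<and> transpose W ** W = mat_on J"
      by (simp add: vec_eq_iff split_sum_all matrix_matrix_mult_def transpose_def hcat_def
          mat_on_def mat_def) blast
    moreover have "transpose W ** U = 0" if "transpose U ** W = 0"
    proof -
      have "transpose (transpose U ** W) = transpose 0" using that by simp
      then show ?thesis
        by (simp only: matrix_transpose_mul transpose_transpose transpose_zero)
    qed
    ultimately show ?thesis by (auto simp: stiefel_def)
  qed
  have 2: "hcat U W ** transpose (hcat U W) = U ** transpose U + W ** transpose W"
    by (simp add: vec_eq_iff matrix_matrix_mult_def transpose_def hcat_def sum.Plus
        flip: UNIV_Plus_UNIV)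
  show ?thesis unfolding orth_completion_def 1 2 by auto
qed

lemma completion_exists:
  fixes U :: "real ^ 'p ^ 'n"
  assumes "U \<in> stiefel"
  obtains J :: "'n set" and W where "orth_completion J U W"
proof -
  define T where "T = {x. transpose U *v x = 0}"
  have "subspace T"
    unfolding T_def subspace_def by (auto simp: matrix_vector_right_distrib matrix_vector_mult_scaleR vector_matrix_left_distrib simp del: transpose_matrix_vector)
  from orthonormal_basis_subspace [OF this] obtain K where K: "K \<subseteq> T" "pairwise orthogonal K"
      "\<And>x. x \<in> K \<Longrightarrow> norm x = 1" "independent K" "card K = dim T" "span K = T"
    by blast
  have finK: "finite K" using K(4) independent_imp_finite by blast
  have "card K \<le> CARD('n)"
    using K(5) dim_subset_UNIV [of T] by simp
  then obtain J :: "'n set" where "card J = card K"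
    by (meson obtain_subset_with_card_n)
  then obtain f where f: "bij_betw f J K"
    using finK by (meson finite finite_same_card_bij)
  define W :: "real ^ 'n ^ 'n" where "W = (\<chi> i j. if j \<in> J then f j $ i else 0)"
  have W: "W \<in> cols_on J" by (auto simp: W_def cols_on_def)
  have fK: "f j \<in> K" if "j \<in> J" for j using f that bij_betwE by blast
  have UW: "transpose U ** W = 0"
  proof -
    have "transpose U *v f j = 0" if "j \<in> J" for j using fK [OF that] K(1) T_def by blast
    then have "(\<Sum>k\<in>UNIV. transpose U $ i $ k * f j $ k) = 0" if "j \<in> J" for i j
      using that by (simp add: vec_eq_iff matrix_vector_mult_def del: transpose_matrix_vector)
    then have "(\<Sum>k\<in>UNIV. transpose U $ i $ k * W $ k $ j) = 0" for i j
      by (cases "j \<in> J") (simp_all add: W_def)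
    then show ?thesis
      by (simp add: vec_eq_iff matrix_matrix_mult_def)
  qed
  have WW: "transpose W ** W = mat_on J"
  proof -
    have "f i \<bullet> f j = (if i = j then 1 else 0)" if "i \<in> J" "j \<in> J" for i j
    proof (cases "i = j")
      case True
      then show ?thesis using K(3) [OF fK [OF that(1)]] by (simp add: norm_eq_1)
    next
      case False
      then have "f i \<noteq> f j" using f that by (meson bij_betw_imp_inj_on inj_on_contraD)
      then show ?thesis using K(2) fK that False by (auto simp: pairwise_def orthogonal_def)
    qed
    then have "(\<Sum>k\<in>UNIV. W $ k $ i * W $ k $ j) = (if i = j \<and> i \<in> J then 1 else 0)" for i j
      by (cases "i \<in> J"; cases "j \<in> J") (auto simp: W_def inner_vec_def)
    then show ?thesis
      by (simp add: vec_eq_iff matrix_matrix_mult_def transpose_def mat_on_def)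
  qed
  have "U ** transpose U + W ** transpose W = mat 1"
  proof (rule matrix_eq [THEN iffD2], rule allI)
    fix x :: "real ^ 'n"
    define y where "y = x - U *v (transpose U *v x)"
    have U1: "transpose U ** U = mat 1" using assms by (simp add: stiefel_def)
    have "transpose U *v y = transpose U *v x - (transpose U ** U) *v (transpose U *v x)"
      unfolding y_def matrix_vector_mult_diff_distrib matrix_vector_mul_assoc matrix_mul_assoc ..
    then have "y \<in> span K" unfolding K(6) T_def U1 by simp
    then have "(\<Sum>k\<in>K. (y \<bullet> k) *\<^sub>R k) = y"
      using orthonormal_basis_expand K(2,3) finK by blast
    then have y: "(\<Sum>j\<in>J. (y \<bullet> f j) *\<^sub>R f j) = y"
      using sum.reindex_bij_betw [OF f, of "\<lambda>k. (y \<bullet> k) *\<^sub>R k"] by simp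
    have Wx: "(W ** transpose W) *v z = (\<Sum>j\<in>J. (z \<bullet> f j) *\<^sub>R f j)" for z
    proof -
      have *: "(transpose W *v z) $ j = (if j \<in> J then z \<bullet> f j else 0)" for j
        by (simp add: matrix_vector_mult_def transpose_def W_def inner_vec_def mult.commute
            del: transpose_matrix_vector)
      have "(W *v (transpose W *v z)) $ i = (\<Sum>j\<in>J. (z \<bullet> f j) *\<^sub>R f j) $ i" for i
        unfolding matrix_vector_mult_def [of W] *
        by (simp add: W_def mult.commute if_distrib [of "\<lambda>x. x * _"] if_distrib [of "\<lambda>x. _ * x"] sum.If_cases cong: if_cong)
      then show ?thesis by (simp add: vec_eq_iff flip: matrix_vector_mul_assoc)
    qed
    have "transpose W ** U = 0"
      using arg_cong [OF UW, of transpose] by (simp add: matrix_transpose_mul transpose_zero)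
    then have "W ** transpose W *v (U *v (transpose U *v x)) = 0"
      by (simp add: matrix_vector_mul_assoc matrix_mult.zero_right del: transpose_matrix_vector flip: matrix_mul_assoc) (simp add: matrix_mul_assoc matrix_mult.zero_left)?
    then have "W ** transpose W *v x = W ** transpose W *v y"
      unfolding y_def matrix_vector_mult_diff_distrib by simp
    also have "\<dots> = y" unfolding Wx y ..
    finally show "(U ** transpose U + W ** transpose W) *v x = mat 1 *v x"
      unfolding matrix_vector_mult_add_rdistrib
      by (simp add: y_def flip: matrix_vector_mul_assoc del: transpose_matrix_vector)
  qed
  with W UW WW assms show ?thesis
    using that by (auto simp: orth_completion_iff)
qed

lemma completion_coords_iff:
  assumes "orth_completion J U W"
  shows "(\<exists>A B. tangent_coords J U W A B D) \<longleftrightarrow> skew (transpose U ** D)"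
proof -
  from assms have W: "W \<in> cols_on J" and U: "transpose U ** U = mat 1" and UW: "transpose U ** W = 0"
    and e: "U ** transpose U + W ** transpose W = mat 1"
    by (auto simp: orth_completion_iff stiefel_def)
  show ?thesis
  proof
    assume "\<exists>A B. tangent_coords J U W A B D"
    then obtain A B where "skew A" "D = U ** A + W ** B" by (auto simp: tangent_coords_def)
    then have "transpose U ** D = A"
      by (simp add: matrix_add_ldistrib matrix_mul_assoc U UW matrix_mult.zero_left)
    with \<open>skew A\<close> show "skew (transpose U ** D)" by simp
  next
    assume s: "skew (transpose U ** D)"
    have "D = (U ** transpose U + W ** transpose W) ** D" by (simp add: e)
    also have "\<dots> = U ** (transpose U ** D) + W ** (transpose W ** D)"
      by (simp add: matrix_mult.add_left matrix_mul_assoc)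
    finally have "D = U ** (transpose U ** D) + W ** (transpose W ** D)" .
    moreover have "transpose W ** D \<in> rows_on J"
      using W by (auto simp: rows_on_def cols_on_def matrix_matrix_mult_def transpose_def)
    ultimately show "\<exists>A B. tangent_coords J U W A B D" using s by (auto simp: tangent_coords_def)
  qed
qed

lemma stiefel_tangent_iff:
  assumes "U \<in> stiefel"
  shows "D \<in> stiefel_tangent U \<longleftrightarrow> skew (transpose U ** D)"
  using completion_exists [OF assms] completion_coords_iff
  unfolding stiefel_tangent_def by (smt (verit) mem_Collect_eq)

text \<open>Every orthogonal completion, over any index type, yields the same tangent space.\<close>

lemma stiefel_tangent_completion:
  assumes "orth_completion J U W"
  shows "stiefel_tangent U = {U ** A + W ** B | A B. skew A \<and> B \<in> rows_on J}"
proof -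
  have "U \<in> stiefel" using assms by (simp add: orth_completion_iff)
  then have "D \<in> stiefel_tangent U \<longleftrightarrow> (\<exists>A B. tangent_coords J U W A B D)" for D
    by (simp add: stiefel_tangent_iff completion_coords_iff [OF assms])
  then show ?thesis by (simp add: set_eq_iff tangent_coords_def) blast
qed

lemma smooth_curve_derivatives:
  fixes c :: "real \<Rightarrow> 'a::euclidean_space"
  assumes "smooth_on UNIV c"
  shows "(c has_vector_derivative velocity c t) (at t)"
    and "(velocity c has_vector_derivative velocity (velocity c) t) (at t)"
proof -
  from assms obtain N h where N: "open N" "t \<in> N" and C: "\<And>k. C_diff_on k N h"
    and eq: "\<And>y. y \<in> N \<Longrightarrow> h y = c y"
    unfolding smooth_on_def by (metis Int_iff UNIV_I)
  have h: "h differentiable at x" if "x \<in> N" for x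
    using C [of 1] that by auto
  have c: "(c has_vector_derivative frechet_derivative h (at x) 1) (at x)" if "x \<in> N" for x
  proof -
    have "(h has_vector_derivative frechet_derivative h (at x) 1) (at x)"
      using h [OF that] by (simp add: vector_derivative_works frechet_derivative_eq_vector_derivative)
    then show ?thesis
      by (rule has_vector_derivative_transform_within_open [OF _ N(1) that]) (rule eq)
  qed
  have v: "velocity c x = frechet_derivative h (at x) 1" if "x \<in> N" for x
    using c [OF that] by (rule vector_derivative_at)
  show "(c has_vector_derivative velocity c t) (at t)"
    using c N(2) v by simp
  have "(\<lambda>x. frechet_derivative h (at x) 1) differentiable at t"
    using C [of 2] N(2) by (simp add: numeral_2_eq_2)
  then have "((\<lambda>x. frechet_derivative h (at x) 1) has_vector_derivative
      vector_derivative (\<lambda>x. frechet_derivative h (at x) 1) (at t)) (at t)"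
    by (simp add: vector_derivative_works)
  then have "(velocity c has_vector_derivative
      vector_derivative (\<lambda>x. frechet_derivative h (at x) 1) (at t)) (at t)"
    by (rule has_vector_derivative_transform_within_open [OF _ N]) (simp add: v)
  then show "(velocity c has_vector_derivative velocity (velocity c) t) (at t)"
    using vector_derivative_at by fastforce
qed

lemma stiefel_metric_frechet_derivative:
  "frechet_derivative (\<lambda>y. stiefel_metric y X Y) (at U) Z =
     - ((transpose Z ** X) \<bullet> (transpose U ** Y) + (transpose U ** X) \<bullet> (transpose Z ** Y)) / 2"
proof -
  have "((\<lambda>y. stiefel_metric y X Y) has_derivative
     (\<lambda>Z. - ((transpose Z ** X) \<bullet> (transpose U ** Y) + (transpose U ** X) \<bullet> (transpose Z ** Y)) / 2)) (at U)"
    unfolding stiefel_metric_inner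
    by (auto intro!: derivative_eq_intros bounded_linear.has_derivative [OF bounded_linear_transpose] matrix_mult.FDERIV
        simp: matrix_mult.zero_right algebra_simps)
  then show ?thesis by (simp add: frechet_derivative_at [symmetric])
qed

lemma inner_sym_skew:
  fixes P Z :: "real ^ 'p ^ 'p"
  assumes "transpose P = P" "transpose Z = - Z"
  shows "P \<bullet> Z = 0"
  using inner_transpose [of P Z] by (simp add: assms)

text \<open>
  The closed formula for the covariant derivative of the velocity of a smooth curve in the Stiefel
  manifold with its canonical metric.
\<close>

lemma stiefel_covariant_acceleration:
  fixes c :: "real \<Rightarrow> real ^ 'p ^ 'n"
  assumes "is_smooth_curve stiefel c"
  defines "v \<equiv> velocity c" and "a \<equiv> velocity (velocity c)"
  shows "covariant_acceleration stiefel_tangent stiefel_metric c t =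
    a t + v t ** transpose (v t) ** c t +
    c t ** ((transpose (c t) ** v t) ** (transpose (c t) ** v t) + transpose (v t) ** v t)"
proof -
  have sm: "smooth_on UNIV c" and St: "\<And>s. c s \<in> stiefel"
    using assms(1) by (auto simp: is_smooth_curve_def)
  then have cc: "transpose (c s) ** c s = mat 1" for s by (simp add: stiefel_def)
  have dc: "(c has_vector_derivative v s) (at s)" and dv: "(v has_vector_derivative a s) (at s)" for s
    using smooth_curve_derivatives [OF sm] by (simp_all add: v_def a_def)
  have mult: "((\<lambda>s. transpose (f s) ** g s) has_vector_derivative
      transpose (f s) ** g' + transpose f' ** g s) (at s)"
    if "(f has_vector_derivative f') (at s)" "(g has_vector_derivative g') (at s)"
    for f g :: "real \<Rightarrow> real ^ 'p ^ 'n" and f' g' s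
    using matrix_mult.has_vector_derivative [OF bounded_linear.has_vector_derivative [OF bounded_linear_transpose that(1)] that(2)] .
  have unique: "x = y" if "(f has_vector_derivative x) (at s)" "(f has_vector_derivative y) (at s)"
    for f :: "real \<Rightarrow> real ^ 'p ^ 'p" and x y s
    using that vector_derivative_unique_at by blast
  have z1: "transpose (c s) ** v s + transpose (v s) ** c s = 0" for s
    using mult [OF dc dc, of s] unfolding cc by (rule unique) (rule has_vector_derivative_const)
  have z2: "(transpose (c s) ** a s + transpose (v s) ** v s) +
      (transpose (v s) ** v s + transpose (a s) ** c s) = 0" for s
    using has_vector_derivative_add [OF mult [OF dc dv, of s] mult [OF dv dc, of s]]
    unfolding z1 by (rule unique) (rule has_vector_derivative_const)
  define U X E where "U = c t" and "X = v t" and "E = a t"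
  define O' where "O' = transpose U ** X"
  define G where "G = transpose X ** X"
  define R where "R = E + X ** transpose X ** U + U ** (O' ** O' + G)"
  have U: "U \<in> stiefel" "transpose U ** U = mat 1" using St cc by (auto simp: U_def)
  have XU: "transpose X ** U = - O'"
    using z1 [of t] by (simp add: O'_def U_def X_def add_eq_0_iff)
  have O't: "transpose O' = - O'" unfolding XU [symmetric] by (simp add: O'_def matrix_transpose_mul)
  have Gt: "transpose G = G" by (simp add: G_def matrix_transpose_mul)
  have OOt: "transpose (O' ** O') = O' ** O'"
    by (simp add: matrix_transpose_mul O't matrix_mult.minus_left matrix_mult.minus_right)
  have EU: "transpose U ** E + G + (G + transpose E ** U) = 0"
    using z2 [of t] by (simp add: G_def U_def X_def E_def)
  have UR: "transpose U ** R = transpose U ** E + G"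
  proof -
    have "transpose U ** R = transpose U ** E + (transpose U ** X) ** (transpose X ** U)
        + (transpose U ** U) ** (O' ** O' + G)"
      by (simp add: R_def matrix_add_ldistrib matrix_mul_assoc)
    then show ?thesis
      unfolding XU U O'_def [symmetric] by (simp add: matrix_mult.minus_right)
  qed
  have R: "R \<in> stiefel_tangent U"
    unfolding stiefel_tangent_iff [OF U(1)] UR skew_def transpose_add Gt
    using EU by (simp add: matrix_transpose_mul add_eq_0_iff algebra_simps)
  have eqn: "stiefel_metric U R Z = stiefel_metric U E Z
      + frechet_derivative (\<lambda>y. stiefel_metric y X Z) (at U) X
      - frechet_derivative (\<lambda>y. stiefel_metric y X X) (at U) Z / 2"
    if "Z \<in> stiefel_tangent U" for Z
  proof -
    define w where "w = transpose U ** Z"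
    have w: "transpose w = - w" using that by (simp add: stiefel_tangent_iff [OF U(1)] skew_def w_def)
    have ZU: "transpose Z ** U = - w" using w by (simp add: w_def matrix_transpose_mul) 
    have G0: "G \<bullet> w = 0" and O0: "(O' ** O') \<bullet> w = 0"
      using inner_sym_skew [OF Gt w] inner_sym_skew [OF OOt w] by auto
    define q where "q = O' \<bullet> (transpose X ** Z)"
    have 1: "(X ** transpose X ** U) \<bullet> Z = - q"
    proof -
      have "(X ** transpose X ** U) \<bullet> Z = (transpose X ** U) \<bullet> (transpose X ** Z)"
        by (simp only: inner_matrix_left flip: matrix_mul_assoc)
      then show ?thesis by (simp add: XU q_def)
    qed
    have 2: "(U ** (O' ** O' + G)) \<bullet> Z = 0"
      by (simp add: inner_matrix_left flip: w_def) (simp add: inner_add_left G0 O0)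
    have 3: "(transpose Z ** X) \<bullet> O' = - q"
    proof -
      have "(transpose Z ** X) \<bullet> O' = (transpose X ** Z) \<bullet> transpose O'"
        using inner_transpose [of "transpose Z ** X" O'] by (simp add: matrix_transpose_mul)
      then show ?thesis by (simp add: O't q_def inner_commute)
    qed
    show ?thesis
      unfolding stiefel_metric_frechet_derivative
      unfolding stiefel_metric_inner UR
      unfolding w_def [symmetric] O'_def [symmetric] G_def [symmetric] R_def inner_add_left 1 2
      using 3 by (simp add: G0 inner_commute q_def field_simps inner_add_right inner_add_left)
  qed
  have pos: "stiefel_metric U Z Z > 0" if "Z \<noteq> 0" for Z
  proof -
    obtain J :: "'n set" and W where W: "orth_completion J U W" using completion_exists [OF U(1)] .
    have e: "U ** transpose U + W ** transpose W = mat 1" using W by (simp add: orth_completion_iff)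
    have "Z \<bullet> Z = Z \<bullet> ((U ** transpose U + W ** transpose W) ** Z)" by (simp add: e)
    also have "\<dots> = (transpose U ** Z) \<bullet> (transpose U ** Z) + (transpose W ** Z) \<bullet> (transpose W ** Z)"
      by (simp add: matrix_mult.add_left inner_add_right inner_matrix_left matrix_mul_assoc inner_commute)
    finally have "(transpose U ** Z) \<bullet> (transpose U ** Z) \<le> Z \<bullet> Z" by simp
    moreover have "Z \<bullet> Z > 0" using that by simp
    ultimately have "(transpose U ** Z) \<bullet> (transpose U ** Z) < 2 * (Z \<bullet> Z)" by linarith
    then show ?thesis by (simp add: stiefel_metric_inner)
  qed
  have diff: "stiefel_metric U (P - Q) Z = stiefel_metric U P Z - stiefel_metric U Q Z" for P Q Z
    by (simp add: stiefel_metric_inner inner_diff_left matrix_mult.diff_right field_simps)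
  have UXE: "c t = U" "velocity c t = X" "velocity (velocity c) t = E"
    by (simp_all add: U_def X_def E_def v_def a_def)
  have "covariant_acceleration stiefel_tangent stiefel_metric c t = R"
    unfolding covariant_acceleration_def Let_def UXE
  proof (rule the_equality, intro conjI ballI)
    fix P
    assume P: "P \<in> stiefel_tangent U \<and> (\<forall>w\<in>stiefel_tangent U. stiefel_metric U P w = stiefel_metric U E w
      + frechet_derivative (\<lambda>y. stiefel_metric y X w) (at U) X
      - frechet_derivative (\<lambda>y. stiefel_metric y X X) (at U) w / 2)"
    have "P - R \<in> stiefel_tangent U"
      using P R by (simp add: stiefel_tangent_iff [OF U(1)] skew_def matrix_mult.diff_right transpose_diff)
    then have "stiefel_metric U (P - R) (P - R) = 0"
      using P eqn by (simp add: diff)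
    then show "P = R" using pos [of "P - R"] by fastforce
  next
    show "R \<in> stiefel_tangent U" by (rule R)
  next
    fix Z assume "Z \<in> stiefel_tangent U"
    then show "stiefel_metric U R Z = stiefel_metric U E Z
      + frechet_derivative (\<lambda>y. stiefel_metric y X Z) (at U) X
      - frechet_derivative (\<lambda>y. stiefel_metric y X X) (at U) Z / 2"
      by (rule eqn)
  qed
  then show ?thesis by (simp add: R_def O'_def G_def U_def X_def E_def)
qed

end

theory Submission
  imports Defs
begin

text \<open>
  Let \<open>X = (I - U U\<^sup>T) D\<close> be the normal part of the tangent vector \<open>D\<close> and \<open>A = U\<^sup>T D\<close>. The matrix
  \<open>\<Omega> = X U\<^sup>T - U X\<^sup>T\<close> is skew-symmetric, and the whole argument rests on the identity
  \<open>RS\<^bsub>U\<^esub>(D) = exp(\<Omega>) U exp(A)\<close> (\<open>stiefel_RS_eq_exp\<close>). Indeed, for every compact singular value decomposition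
  \<open>X = Q \<Sigma> V\<^sup>T\<close> the curve \<open>(U V cos(t\<Sigma>) + Q sin(t\<Sigma>)) V\<^sup>T\<close> solves the linear equation \<open>F' = \<Omega> F\<close>
  with \<open>F(0) = U\<close>, so it equals \<open>exp(t\<Omega>) U\<close> (\<open>mat_exp_stiefel_rot_svd\<close>). This shows at once that
  the map does not depend on the decomposition, that its values are in the Stiefel manifold, and that
  it extends smoothly to all pairs of matrices. A decomposition exists for every tangent vector
  (\<open>compact_svd_exists\<close>), hence the map is defined on the whole tangent bundle.

  Smoothness is reduced to that of the matrix exponential (\<open>C_diff_on_mat_exp\<close>), whose power series
  is differentiated term by term along any number of directions. The derivative of
  \<open>D \<mapsto> exp(\<Omega>) U exp(A)\<close> at \<open>0\<close> is \<open>D \<mapsto> \<Omega> U + U A = X + U U\<^sup>T D = D\<close>.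

  For \<open>D = U A + W B\<close> one has \<open>\<Omega> U = W B\<close> and \<open>\<Omega> W = - U B\<^sup>T\<close>, in other words \<open>\<Omega>\<close> acts on \<open>(U W)\<close> as
  right multiplication by the block matrix of the completion, so \<open>\<gamma>\<^sub>\<perp>(t) = exp(t\<Omega>) W\<close>
  (\<open>mat_exp_block\<close>). The derivatives of \<open>\<gamma>(t) = exp(t\<Omega>) U exp(tA)\<close> and \<open>\<gamma>\<^sub>\<perp>\<close> then follow from the
  product rule; speed and covariant acceleration follow from the orthogonality relations between
  \<open>\<gamma>\<close> and \<open>\<gamma>\<^sub>\<perp>\<close>. Since \<open>D\<^sub>t \<gamma>'\<close> has norm \<open>\<parallel>B A\<parallel>\<close> for all \<open>t\<close>, the curve is a geodesic iff \<open>B A = 0\<close>.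
\<close>

section \<open>Calculus of functions of class \<open>C\<^sup>k\<close>\<close>

lemma C_diff_on_cong:
  assumes "open S" "C_diff_on k S f" "\<And>x. x \<in> S \<Longrightarrow> f x = g x"
  shows "C_diff_on k S g"
  using assms(2,3)
proof (induction k arbitrary: f g)
  case 0
  then show ?case by (simp cong: continuous_on_cong)
next
  case (Suc k)
  have d: "(g has_derivative frechet_derivative f (at x)) (at x)" if "x \<in> S" for x
  proof (rule has_derivative_transform_within_open [OF _ \<open>open S\<close> that])
    show "(f has_derivative frechet_derivative f (at x)) (at x)"
      using Suc.prems(1) that by (simp add: frechet_derivative_works)
  qed (rule Suc.prems(2))
  then have eq: "frechet_derivative f (at x) = frechet_derivative g (at x)" if "x \<in> S" for x
    using that by (intro frechet_derivative_at)
  have "C_diff_on k S (\<lambda>x. frechet_derivative g (at x) v)" for v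
  proof (rule Suc.IH)
    show "C_diff_on k S (\<lambda>x. frechet_derivative f (at x) v)" using Suc.prems(1) by simp
  qed (simp add: eq)
  with d show ?case by (auto simp: differentiable_def)
qed

lemma C_diff_on_SucI:
  assumes "open S" "\<And>x. x \<in> S \<Longrightarrow> (f has_derivative f' x) (at x)"
    and "\<And>v. C_diff_on k S (\<lambda>x. f' x v)"
  shows "C_diff_on (Suc k) S f"
proof -
  have "C_diff_on k S (\<lambda>x. frechet_derivative f (at x) v)" for v
    by (rule C_diff_on_cong [OF assms(1,3)]) (simp add: frechet_derivative_at [OF assms(2), symmetric])
  with assms(2) show ?thesis by (auto simp: differentiable_def)
qed

lemma C_diff_on_SucD:
  assumes "C_diff_on (Suc k) S f" "x \<in> S"
  shows "(f has_derivative frechet_derivative f (at x)) (at x)"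
  using assms by (simp add: frechet_derivative_works)

lemma C_diff_on_Suc_lower: "C_diff_on (Suc k) S f \<Longrightarrow> C_diff_on k S f"
proof (induction k arbitrary: f)
  case 0
  then show ?case
    by (auto intro: continuous_at_imp_continuous_on differentiable_imp_continuous_within)
next
  case (Suc k)
  have "C_diff_on k S (\<lambda>x. frechet_derivative f (at x) v)" for v
    using Suc.prems by (intro Suc.IH) auto
  with Suc.prems show ?case by auto
qed

lemma C_diff_on_const: "C_diff_on k S (\<lambda>x. c)"
  by (induction k arbitrary: c) auto

lemma C_diff_on_bounded_linear:
  assumes "open S" "bounded_linear f"
  shows "C_diff_on k S f"
proof (cases k)
  case 0
  then show ?thesis by (simp add: linear_continuous_on assms(2))
next
  case (Suc j)
  then show ?thesis
    using C_diff_on_SucI [OF assms(1) bounded_linear_imp_has_derivative [OF assms(2)] C_diff_on_const]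
    by blast
qed

lemma C_diff_on_add:
  assumes "open S" "C_diff_on k S f" "C_diff_on k S g"
  shows "C_diff_on k S (\<lambda>x. f x + g x)"
  using assms(2,3)
proof (induction k arbitrary: f g)
  case 0
  then show ?case by (simp add: continuous_on_add)
next
  case (Suc k)
  show ?case
  proof (rule C_diff_on_SucI [OF assms(1)])
    show "((\<lambda>x. f x + g x) has_derivative
        (\<lambda>v. frechet_derivative f (at x) v + frechet_derivative g (at x) v)) (at x)"
      if "x \<in> S" for x
      using Suc.prems that by (intro has_derivative_add C_diff_on_SucD)
    show "C_diff_on k S (\<lambda>x. frechet_derivative f (at x) v + frechet_derivative g (at x) v)" for v
      using Suc.prems by (intro Suc.IH) auto
  qed
qed

lemma C_diff_on_sum:
  assumes "open S" "\<And>i. i \<in> I \<Longrightarrow> C_diff_on k S (f i)"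
  shows "C_diff_on k S (\<lambda>x. \<Sum>i\<in>I. f i x)"
  using assms(2)
  by (induction I rule: infinite_finite_induct) (simp_all add: C_diff_on_const C_diff_on_add assms(1))

lemma C_diff_on_bilinear:
  assumes "open S" "bounded_bilinear mul" "C_diff_on k S f" "C_diff_on k S g"
  shows "C_diff_on k S (\<lambda>x. mul (f x) (g x))"
  using assms(3,4)
proof (induction k arbitrary: f g)
  case 0
  then show ?case by (simp add: bounded_bilinear.continuous_on [OF assms(2)])
next
  case (Suc k)
  show ?case
  proof (rule C_diff_on_SucI [OF assms(1)])
    show "((\<lambda>x. mul (f x) (g x)) has_derivative
        (\<lambda>v. mul (f x) (frechet_derivative g (at x) v) + mul (frechet_derivative f (at x) v) (g x))) (at x)"
      if "x \<in> S" for x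
      using Suc.prems that by (intro bounded_bilinear.FDERIV [OF assms(2)] C_diff_on_SucD)
    show "C_diff_on k S (\<lambda>x. mul (f x) (frechet_derivative g (at x) v)
        + mul (frechet_derivative f (at x) v) (g x))" for v
      using Suc.prems C_diff_on_Suc_lower [OF Suc.prems(1)] C_diff_on_Suc_lower [OF Suc.prems(2)]
      by (intro C_diff_on_add assms(1) Suc.IH) auto
  qed
qed

text \<open>
  In the chain rule the outer derivative is taken in the direction \<open>Dg(x) v\<close>, which varies with \<open>x\<close>.
  Expanding this direction in the standard basis leaves only derivatives in fixed directions.
\<close>

lemma C_diff_on_compose:
  fixes f :: "'b::euclidean_space \<Rightarrow> 'c::real_normed_vector"
  assumes "open S" "open T" "g ` S \<subseteq> T" "C_diff_on k S g" "C_diff_on k T f"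
  shows "C_diff_on k S (\<lambda>x. f (g x))"
  using assms(4,5)
proof (induction k arbitrary: f)
  case 0
  then show ?case using assms(3) by (auto intro: continuous_on_compose2)
next
  case (Suc k)
  let ?g = "\<lambda>x. frechet_derivative g (at x)" and ?f = "\<lambda>y. frechet_derivative f (at y)"
  show ?case
  proof (rule C_diff_on_SucI [OF assms(1)])
    fix x assume x: "x \<in> S"
    have df: "(f has_derivative ?f (g x)) (at (g x))"
      using Suc.prems(2) x assms(3) by (intro C_diff_on_SucD) auto
    have der: "((\<lambda>x. f (g x)) has_derivative (\<lambda>v. ?f (g x) (?g x v))) (at x)"
      using has_derivative_compose [OF C_diff_on_SucD [OF Suc.prems(1) x] df] .
    have rep: "?f (g x) w = (\<Sum>b\<in>Basis. (w \<bullet> b) *\<^sub>R ?f (g x) b)" for w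
    proof -
      have lin: "linear (?f (g x))" using df by (rule has_derivative_linear)
      have "?f (g x) (\<Sum>b\<in>Basis. (w \<bullet> b) *\<^sub>R b) = (\<Sum>b\<in>Basis. (w \<bullet> b) *\<^sub>R ?f (g x) b)"
        by (simp only: linear_sum [OF lin] linear_scale [OF lin])
      then show ?thesis by (simp only: euclidean_representation)
    qed
    show "((\<lambda>x. f (g x)) has_derivative
        (\<lambda>v. \<Sum>b\<in>Basis. (?g x v \<bullet> b) *\<^sub>R ?f (g x) b)) (at x)"
      by (rule has_derivative_eq_rhs [OF der]) (rule ext, rule rep)
  next
    fix v
    have "C_diff_on k S (\<lambda>x. ?g x v \<bullet> b)" for b
      using Suc.prems by (intro C_diff_on_bilinear [OF assms(1) bounded_bilinear_inner] C_diff_on_const) auto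
    moreover have "C_diff_on k S (\<lambda>x. ?f (g x) b)" for b
      using Suc.prems C_diff_on_Suc_lower [OF Suc.prems(1)] by (intro Suc.IH) auto
    ultimately show "C_diff_on k S (\<lambda>x. \<Sum>b\<in>Basis. (?g x v \<bullet> b) *\<^sub>R ?f (g x) b)"
      by (intro C_diff_on_sum assms(1) C_diff_on_bilinear [OF assms(1) bounded_bilinear_scaleR])
  qed
qed

lemma C_diff_on_bounded_linear_compose:
  fixes g :: "'a::euclidean_space \<Rightarrow> 'b::euclidean_space"
  assumes "open S" "C_diff_on k S g" "bounded_linear f"
  shows "C_diff_on k S (\<lambda>x. f (g x))"
  using C_diff_on_compose [OF assms(1) open_UNIV _ assms(2) C_diff_on_bounded_linear [OF open_UNIV assms(3)]]
  by simp

lemma C_diff_on_matrix_mult: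
  fixes f :: "'a::euclidean_space \<Rightarrow> real ^ 'k ^ 'n" and g :: "'a \<Rightarrow> real ^ 'p ^ 'k"
  assumes "open S" "C_diff_on k S f" "C_diff_on k S g"
  shows "C_diff_on k S (\<lambda>x. f x ** g x)"
  using assms(1) matrix_mult.bounded_bilinear_axioms assms(2,3) by (rule C_diff_on_bilinear)

lemma has_vector_derivative_matrix:
  fixes f :: "real \<Rightarrow> real ^ 'p ^ 'n"
  assumes "\<And>i j. ((\<lambda>t. f t $ i $ j) has_real_derivative f' $ i $ j) (at t)"
  shows "(f has_vector_derivative f') (at t)"
proof -
  have "((\<lambda>t. f t \<bullet> b) has_derivative (\<lambda>h. (h *\<^sub>R f') \<bullet> b)) (at t)" if B: "b \<in> Basis" for b
  proof -
    obtain i j where b: "b = axis i (axis j 1)"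
      using B by (auto simp: Basis_vec_def)
    have "X \<bullet> b = X $ i $ j" for X :: "real ^ 'p ^ 'n"
      by (simp add: b inner_axis)
    then show ?thesis
      using assms [of i j] by (simp add: has_field_derivative_def mult_commute_abs)
  qed
  then show ?thesis
    unfolding has_vector_derivative_def by (subst has_derivative_componentwise_within) blast
qed

section \<open>Matrix algebra\<close>

text \<open>
  Products are normalized by associating to the right; a relation \<open>A B = C\<close> is then needed in the
  following form to be applied inside a longer product.
\<close>

lemma matrix_mul_cancel: "A ** B = C \<Longrightarrow> A ** (B ** P) = C ** P"
  by (simp add: matrix_mul_assoc)

lemma transpose_minus: "transpose (- A) = - transpose A" for A :: "real ^ 'p ^ 'n"
  by (rule linear_neg [OF bounded_linear.linear [OF bounded_linear_transpose]])

lemma transpose_scaleR: "transpose (r *\<^sub>R A) = r *\<^sub>R transpose A" for A :: "real ^ 'p ^ 'n"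
  by (rule linear_scale [OF bounded_linear.linear [OF bounded_linear_transpose]])

lemmas matrix_distribs =
  matrix_mult.add_left matrix_mult.add_right matrix_mult.diff_left matrix_mult.diff_right
  matrix_mult.minus_left matrix_mult.minus_right matrix_mult.zero_left matrix_mult.zero_right
  matrix_mult.scaleR_left matrix_mult.scaleR_right
  transpose_add transpose_diff transpose_minus transpose_zero transpose_scaleR
  matrix_transpose_mul

lemma skew_scaleR: "skew A \<Longrightarrow> skew (t *\<^sub>R A)"
  by (simp add: skew_def matrix_distribs)

lemma inner_matrix_right:
  fixes X Y :: "real ^ 'p ^ 'n"
  assumes "e ** transpose e = mat 1"
  shows "(X ** e) \<bullet> (Y ** e) = X \<bullet> Y"
proof -
  have "(X ** e) \<bullet> (Y ** e) = (transpose e ** transpose X) \<bullet> (transpose e ** transpose Y)"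
    using inner_transpose [of "X ** e" "Y ** e"] by (simp add: matrix_transpose_mul)
  also have "\<dots> = transpose X \<bullet> transpose Y"
    by (simp add: inner_matrix_left matrix_mul_assoc assms)
  finally show ?thesis by (simp add: inner_transpose)
qed

lemma matrix_mult_hcat: "A ** hcat X Y = hcat (A ** X) (A ** Y)"
  by (auto simp: vec_eq_iff matrix_matrix_mult_def hcat_def split: sum.split)

lemma hcat_mult_vcat: "hcat X Y ** vcat P R = X ** P + Y ** R"
  by (simp add: vec_eq_iff matrix_matrix_mult_def hcat_def vcat_def sum.Plus flip: UNIV_Plus_UNIV)

lemma hcat_add: "hcat X Y + hcat X' Y' = hcat (X + X') (Y + Y')"
  by (auto simp: vec_eq_iff hcat_def split: sum.split)

lemma mat_on_mult:
  assumes "B \<in> rows_on J"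
  shows "mat_on J ** B = B"
proof -
  have "(mat_on J ** B) $ i $ j = B $ i $ j" for i j
    using assms
    by (cases "i \<in> J") (simp_all add: matrix_matrix_mult_def mat_on_def rows_on_def
        if_distrib [of "\<lambda>x. x * _"] cong: if_cong)
  then show ?thesis by (simp add: vec_eq_iff)
qed

lemma mult_mat_on:
  assumes "W \<in> cols_on J"
  shows "W ** mat_on J = W"
proof -
  have "transpose W \<in> rows_on J" using assms by (simp add: rows_on_def cols_on_def transpose_def)
  then have "transpose (mat_on J ** transpose W) = W" by (simp add: mat_on_mult)
  moreover have "transpose (mat_on J) = (mat_on J :: real ^ 'a ^ 'a)"
    by (auto simp: transpose_def mat_on_def vec_eq_iff)
  ultimately show ?thesis by (simp add: matrix_transpose_mul)
qed

lemma transpose_rows_on: "B \<in> rows_on J \<Longrightarrow> transpose B \<in> cols_on J"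
  by (simp add: rows_on_def cols_on_def transpose_def)

section \<open>The matrix exponential\<close>

lemma mat_pow_Suc_right: "mat_pow A (Suc n) = mat_pow A n ** A"
  by (induction n) (simp_all add: matrix_mul_assoc)

lemma mat_pow_transpose: "mat_pow (transpose A) n = transpose (mat_pow A n)"
proof (induction n)
  case (Suc n)
  then show ?case
    by (simp only: mat_pow_Suc_right [of A] matrix_transpose_mul) simp
qed simp

lemma mat_pow_intertwine:
  assumes "A ** Z = Z ** M"
  shows "mat_pow A n ** Z = Z ** mat_pow M n"
proof (induction n)
  case (Suc n)
  have "mat_pow A (Suc n) ** Z = A ** (Z ** mat_pow M n)"
    by (simp add: Suc flip: matrix_mul_assoc)
  also have "\<dots> = Z ** mat_pow M (Suc n)" by (simp add: matrix_mul_assoc assms)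
  finally show ?case .
qed simp

text \<open>
  \<open>pow_deriv n [E\<^sub>1, \<dots>, E\<^sub>k] A\<close> is the \<open>k\<close>-th derivative of \<open>X \<mapsto> X\<^sup>n\<close> at \<open>A\<close> in the directions
  \<open>E\<^sub>1, \<dots>, E\<^sub>k\<close>: the recursion is the Leibniz rule for \<open>X \<mapsto> X X\<^sup>n\<close>, where at most one
  derivative falls on the first factor.
\<close>

primrec pow_deriv :: "nat \<Rightarrow> (real ^ 'p ^ 'p) list \<Rightarrow> real ^ 'p ^ 'p \<Rightarrow> real ^ 'p ^ 'p" where
  "pow_deriv 0 Es A = (if Es = [] then mat 1 else 0)"
| "pow_deriv (Suc n) Es A = A ** pow_deriv n Es A +
     (\<Sum>i<length Es. Es ! i ** pow_deriv n (take i Es @ drop (Suc i) Es) A)"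

lemma pow_deriv_Nil: "pow_deriv n [] A = mat_pow A n"
  by (induction n) simp_all

lemma pow_deriv_has_derivative:
  "(pow_deriv n Es has_derivative (\<lambda>E. pow_deriv n (E # Es) A)) (at A)"
proof (induction n arbitrary: Es)
  case (Suc n)
  have "((\<lambda>A. A ** pow_deriv n Es A +
     (\<Sum>i<length Es. Es ! i ** pow_deriv n (take i Es @ drop (Suc i) Es) A)) has_derivative
     (\<lambda>E. (A ** pow_deriv n (E # Es) A + E ** pow_deriv n Es A) +
     (\<Sum>i<length Es. Es ! i ** pow_deriv n (E # take i Es @ drop (Suc i) Es) A))) (at A)"
    by (intro has_derivative_add matrix_mult.FDERIV has_derivative_ident Suc has_derivative_sum
        bounded_linear.has_derivative [OF matrix_mult.bounded_linear_right])
  then show ?case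
    by (simp only: pow_deriv.simps list.size add_0_right sum.lessThan_Suc_shift
        add_Suc_right nth_Cons_Suc nth_Cons_0 take_Suc_Cons take_0 drop_Suc_Cons drop_0 append_Cons append_Nil add.assoc)
next
  case 0
  have "pow_deriv 0 Es = (\<lambda>_. if Es = [] then mat 1 else 0)" by auto
  then show ?case by simp
qed

text \<open>
  The bound is \<open>k! (K s)\<^sup>n\<close> up to a constant, where \<open>k\<close> is the number of directions, \<open>s\<close> bounds the sum of
  the norms of the base point and of the directions, and \<open>\<parallel>X Y\<parallel> \<le> K \<parallel>X\<parallel> \<parallel>Y\<parallel>\<close>.
\<close>

lemma pow_deriv_bound:
  obtains K where "K > 0" "\<And>n Es (A :: real ^ 'p ^ 'p) s. norm A + sum_list (map norm Es) \<le> s \<Longrightarrow>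
    norm (pow_deriv n Es A) \<le> norm (mat 1 :: real ^ 'p ^ 'p) * fact (length Es) * (K * s) ^ n"
proof -
  obtain K where K: "K > 0" "\<And>(X :: real ^ 'p ^ 'p) (Y :: real ^ 'p ^ 'p). norm (X ** Y) \<le> norm X * norm Y * K"
    using matrix_mult.pos_bounded by blast
  have "norm (pow_deriv n Es A) \<le> norm (mat 1 :: real ^ 'p ^ 'p) * fact (length Es) * (K * s) ^ n"
    if "norm A + sum_list (map norm Es) \<le> s" for n Es s and A :: "real ^ 'p ^ 'p"
    using that
  proof (induction n arbitrary: Es)
    case 0
    then show ?case by simp
  next
    case (Suc n)
    define C where "C = norm (mat 1 :: real ^ 'p ^ 'p) * fact (length Es) * (K * s) ^ n"
    have s: "s \<ge> 0" using Suc.prems by (smt (verit) norm_ge_zero sum_list_nonneg imageE list.set_map)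
    have C: "C \<ge> 0" using s K(1) by (simp add: C_def)
    have 1: "norm (A ** pow_deriv n Es A) \<le> norm A * (C * K)"
    proof -
      have "norm (A ** pow_deriv n Es A) \<le> norm A * norm (pow_deriv n Es A) * K" by (rule K(2))
      also have "\<dots> \<le> norm A * C * K"
        using Suc.IH [OF Suc.prems] K(1) by (intro mult_right_mono mult_left_mono) (auto simp: C_def)
      finally show ?thesis by (simp add: mult.assoc)
    qed
    have 2: "norm (Es ! i ** pow_deriv n (take i Es @ drop (Suc i) Es) A) \<le> norm (Es ! i) * (C * K)"
      if i: "i < length Es" for i
    proof -
      let ?F = "take i Es @ drop (Suc i) Es"
      have "sum_list (map norm Es) = sum_list (map norm (take i Es @ Es ! i # drop (Suc i) Es))"
        using i by (simp only: id_take_nth_drop [symmetric])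
      then have "norm A + sum_list (map norm ?F) \<le> s"
        using Suc.prems norm_ge_zero [of "Es ! i"] by (simp only: map_append list.map sum_list_append sum_list.Cons)
      then have "norm (pow_deriv n ?F A) \<le> norm (mat 1 :: real ^ 'p ^ 'p) * fact (length ?F) * (K * s) ^ n"
        by (rule Suc.IH)
      also have "\<dots> \<le> C"
        unfolding C_def using s K(1) i by (intro mult_right_mono mult_left_mono fact_mono) auto
      finally have P: "norm (pow_deriv n ?F A) \<le> C" .
      have "norm (Es ! i ** pow_deriv n ?F A) \<le> norm (Es ! i) * norm (pow_deriv n ?F A) * K" by (rule K(2))
      also have "\<dots> \<le> norm (Es ! i) * C * K"
        using P K(1) by (intro mult_right_mono mult_left_mono) auto
      finally show ?thesis by (simp add: mult.assoc)
    qed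
    have "norm (pow_deriv (Suc n) Es A) \<le> norm A * (C * K) + (\<Sum>i<length Es. norm (Es ! i) * (C * K))"
      unfolding pow_deriv.simps
      by (intro norm_triangle_mono 1 sum_norm_le 2) auto
    also have "\<dots> = (norm A + sum_list (map norm Es)) * (C * K)"
      by (simp add: sum_list_sum_nth sum_distrib_right distrib_right atLeast0LessThan)
    also have "\<dots> \<le> s * (C * K)" using Suc.prems C K(1) by (intro mult_right_mono) auto
    finally show ?case by (simp add: C_def algebra_simps)
  qed
  with K(1) show ?thesis using that by blast
qed

text \<open>The iterated derivative of the matrix exponential at \<open>A\<close> in the directions \<open>Es\<close>.\<close>

definition exp_deriv :: "(real ^ 'p ^ 'p) list \<Rightarrow> real ^ 'p ^ 'p \<Rightarrow> real ^ 'p ^ 'p" where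
  "exp_deriv Es A = (\<Sum>n. (1 / fact n) *\<^sub>R pow_deriv n Es A)"

lemma summable_exp_bound: "summable (\<lambda>n. c * (r ^ n / fact n))" for c r :: real
  using summable_exp [of r] by (intro summable_mult) (simp add: divide_inverse mult.commute)

lemma exp_deriv_sums:
  fixes A :: "real ^ 'p ^ 'p"
  shows "(\<lambda>n. (1 / fact n) *\<^sub>R pow_deriv n Es A) sums exp_deriv Es A"
proof -
  obtain K where K: "\<And>n Es (A :: real ^ 'p ^ 'p) s. norm A + sum_list (map norm Es) \<le> s \<Longrightarrow>
    norm (pow_deriv n Es A) \<le> norm (mat 1 :: real ^ 'p ^ 'p) * fact (length Es) * (K * s) ^ n"
    using pow_deriv_bound by metis
  have "summable (\<lambda>n. (1 / fact n) *\<^sub>R pow_deriv n Es A)"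
  proof (rule summable_comparison_test' [OF summable_exp_bound])
    show "norm ((1 / fact n) *\<^sub>R pow_deriv n Es A) \<le> (norm (mat 1 :: real ^ 'p ^ 'p) * fact (length Es)) *
        ((K * (norm A + sum_list (map norm Es))) ^ n / fact n)" for n
      using K [where A = A and Es = Es, OF order_refl] by (simp add: divide_right_mono)
  qed
  then show ?thesis unfolding exp_deriv_def by (rule summable_sums)
qed

lemma mat_exp_sums: "(\<lambda>n. (1 / fact n) *\<^sub>R mat_pow A n) sums mat_exp A"
  using exp_deriv_sums [of "[]" A] by (simp add: exp_deriv_def mat_exp_def pow_deriv_Nil)

lemma mat_exp_eq: "mat_exp = exp_deriv []"
  by (simp add: fun_eq_iff exp_deriv_def mat_exp_def pow_deriv_Nil)

lemma exp_deriv_has_derivative: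
  fixes A :: "real ^ 'p ^ 'p"
  shows "(exp_deriv Es has_derivative (\<lambda>E. exp_deriv (E # Es) A)) (at A)"
proof -
  define c where "c = norm (mat 1 :: real ^ 'p ^ 'p) * fact (Suc (length Es))"
  obtain K where K: "K > 0" "\<And>n Es A s. norm A + sum_list (map norm Es) \<le> s \<Longrightarrow>
    norm (pow_deriv n Es A :: real ^ 'p ^ 'p) \<le> norm (mat 1 :: real ^ 'p ^ 'p) * fact (length Es) * (K * s) ^ n"
    using pow_deriv_bound by blast
  define R where "R = norm A + 1"
  \<comment> \<open>The summand \<open>1\<close> accounts for the new direction, taken of norm \<open>1\<close>.\<close>
  define s where "s = R + 1 + sum_list (map norm Es)"
  let ?S = "ball (0 :: real ^ 'p ^ 'p) R"
  let ?f = "\<lambda>n A. (1 / fact n) *\<^sub>R pow_deriv n Es A"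
  let ?f' = "\<lambda>n A E. (1 / fact n) *\<^sub>R pow_deriv n (E # Es) A"
  have der: "(?f n has_derivative ?f' n X) (at X)" for n X
    by (intro bounded_linear.has_derivative [OF bounded_linear_scaleR_right] pow_deriv_has_derivative)
  have scale: "?f' n X (r *\<^sub>R E) = r *\<^sub>R ?f' n X E" for n X r E
    using has_derivative_linear [OF der, of n X] by (rule linear_scale)
  have scale': "exp_deriv (r *\<^sub>R E # Es) X = r *\<^sub>R exp_deriv (E # Es) X" for X r E
    by (rule sums_unique2 [OF exp_deriv_sums])
      (simp only: scale sums_scaleR_right [OF exp_deriv_sums])
  have "uniform_limit (?S \<times> sphere 0 1) (\<lambda>n z. \<Sum>i<n. ?f' i (fst z) (snd z))
      (\<lambda>z. \<Sum>i. ?f' i (fst z) (snd z)) sequentially"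
  proof (rule Weierstrass_m_test [OF _ summable_exp_bound])
    fix n z assume z: "z \<in> ?S \<times> sphere (0 :: real ^ 'p ^ 'p) 1"
    then have "norm (pow_deriv n (snd z # Es) (fst z)) \<le> c * (K * s) ^ n"
      unfolding c_def using K(2) [of "fst z" "snd z # Es" s n] by (auto simp: s_def)
    then show "norm (?f' n (fst z) (snd z)) \<le> c * ((K * s) ^ n / fact n)"
      by (simp add: divide_right_mono)
  qed
  then have lim: "\<forall>\<^sub>F n in sequentially. \<forall>z \<in> ?S \<times> sphere 0 1.
      dist (\<Sum>i<n. ?f' i (fst z) (snd z)) (\<Sum>i. ?f' i (fst z) (snd z)) < e" if "e > 0" for e
    using that by (rule uniform_limitD)
  have "\<exists>g. \<forall>X\<in>?S. (\<lambda>n. ?f n X) sums g X \<and> (g has_derivative (\<lambda>E. exp_deriv (E # Es) X)) (at X within ?S)"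
  proof (rule has_derivative_series)
    show "convex ?S" by simp
    show "(?f n has_derivative ?f' n X) (at X within ?S)" for n X
      using der has_derivative_at_withinI by blast
    show "A \<in> ?S" by (simp add: R_def)
    show "(\<lambda>n. ?f n A) sums exp_deriv Es A" by (rule exp_deriv_sums)
    fix e :: real assume "e > 0"
    from lim [OF this] show "\<forall>\<^sub>F n in sequentially. \<forall>X\<in>?S. \<forall>h.
        norm ((\<Sum>i<n. ?f' i X h) - exp_deriv (h # Es) X) \<le> e * norm h"
    proof (rule eventually_mono, intro ballI allI)
      fix n X and h :: "real ^ 'p ^ 'p"
      assume n: "\<forall>z \<in> ?S \<times> sphere 0 1. dist (\<Sum>i<n. ?f' i (fst z) (snd z)) (\<Sum>i. ?f' i (fst z) (snd z)) < e"
        and X: "X \<in> ?S"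
      \<comment> \<open>Both sides are homogeneous in \<open>h\<close>, so it suffices to look at unit vectors.\<close>
      obtain u where u: "norm u = 1" and h: "h = norm h *\<^sub>R u"
      proof (cases "h = 0")
        case True
        then show ?thesis using that [of "axis undefined (axis undefined 1)"] by (simp add: norm_eq_1 inner_axis_axis)
      next
        case False
        then show ?thesis using that [of "h /\<^sub>R norm h"] by simp
      qed
      have "dist (\<Sum>i<n. ?f' i X u) (exp_deriv (u # Es) X) < e"
        using n [rule_format, of "(X, u)"] X u by (simp add: exp_deriv_def)
      then have "norm h * norm ((\<Sum>i<n. ?f' i X u) - exp_deriv (u # Es) X) \<le> norm h * e"
        by (intro mult_left_mono) (simp_all add: dist_norm)
      moreover have "(\<Sum>i<n. ?f' i X h) - exp_deriv (h # Es) X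
          = norm h *\<^sub>R ((\<Sum>i<n. ?f' i X u) - exp_deriv (u # Es) X)"
        by (subst (1 2) h) (simp only: scale scale' scaleR_sum_right scaleR_diff_right)
      ultimately show "norm ((\<Sum>i<n. ?f' i X h) - exp_deriv (h # Es) X) \<le> e * norm h"
        by (simp add: mult.commute)
    qed
  qed
  then obtain g where g: "\<And>X. X \<in> ?S \<Longrightarrow> (\<lambda>n. ?f n X) sums g X"
    "\<And>X. X \<in> ?S \<Longrightarrow> (g has_derivative (\<lambda>E. exp_deriv (E # Es) X)) (at X within ?S)" by blast
  have A: "A \<in> ?S" by (simp add: R_def)
  then have "(g has_derivative (\<lambda>E. exp_deriv (E # Es) A)) (at A)"
    using g(2) [OF A] by (simp only: at_within_open [OF A open_ball])
  then show ?thesis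
    by (rule has_derivative_transform_within_open [OF _ open_ball A])
      (use g(1) exp_deriv_sums sums_unique2 in blast)
qed

lemma C_diff_on_exp_deriv:
  assumes "open S"
  shows "C_diff_on k S (exp_deriv Es)"
proof (induction k arbitrary: Es)
  case 0
  then show ?case
    using exp_deriv_has_derivative
    by (auto intro: continuous_at_imp_continuous_on has_derivative_continuous)
next
  case (Suc k)
  show ?case by (rule C_diff_on_SucI [OF assms exp_deriv_has_derivative Suc])
qed

lemma C_diff_on_mat_exp: "open S \<Longrightarrow> C_diff_on k S mat_exp"
  using C_diff_on_exp_deriv [of S k "[]"] by (simp flip: mat_exp_eq)

lemma mat_exp_has_derivative: "(mat_exp has_derivative (\<lambda>E. exp_deriv [E] A)) (at A)"
  using exp_deriv_has_derivative [of "[]" A] by (simp flip: mat_exp_eq)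

text \<open>
  The matrix \<open>Z\<close> may be rectangular. This covers both commutation and the passage from the
  ambient rotation to the block matrix acting on an orthogonal completion.
\<close>

lemma mat_exp_intertwine:
  fixes Z :: "real ^ 'p ^ 'n"
  assumes "A ** Z = Z ** M"
  shows "mat_exp A ** Z = Z ** mat_exp M"
proof (rule sums_unique2)
  show "(\<lambda>n. (1 / fact n) *\<^sub>R mat_pow A n ** Z) sums (mat_exp A ** Z)"
    by (rule bounded_linear.sums [OF matrix_mult.bounded_linear_left mat_exp_sums])
  show "(\<lambda>n. (1 / fact n) *\<^sub>R mat_pow A n ** Z) sums (Z ** mat_exp M)"
    using bounded_linear.sums [OF matrix_mult.bounded_linear_right mat_exp_sums, of Z M]
    by (simp add: matrix_mult.scaleR_left matrix_mult.scaleR_right mat_pow_intertwine [OF assms])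
qed

lemma exp_deriv_commute:
  assumes "A ** E = E ** A"
  shows "exp_deriv [E] A = E ** mat_exp A"
proof (rule sums_unique2 [OF exp_deriv_sums])
  have P: "pow_deriv (Suc n) [E] A = real (Suc n) *\<^sub>R (E ** mat_pow A n)" for n
  proof (induction n)
    case 0
    then show ?case by (simp add: matrix_mult.zero_right)
  next
    case (Suc n)
    have "A ** (E ** mat_pow A n) = E ** mat_pow A (Suc n)"
      by (simp add: matrix_mul_assoc assms)
    with Suc show ?case
      by (simp add: matrix_mult.scaleR_right matrix_mult.add_right matrix_mult.zero_right
          pow_deriv_Nil scaleR_add_left scaleR_2)
  qed
  have "(1 / fact (Suc n)) *\<^sub>R pow_deriv (Suc n) [E] A = (1 / fact n) *\<^sub>R (E ** mat_pow A n)" for n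
    unfolding P by (simp del: of_nat_Suc)
  then have "(\<lambda>n. (1 / fact (Suc n)) *\<^sub>R pow_deriv (Suc n) [E] A) sums (E ** mat_exp A)"
    using bounded_linear.sums [OF matrix_mult.bounded_linear_right mat_exp_sums, of E A]
    by (simp only: matrix_mult.scaleR_right)
  then show "(\<lambda>n. (1 / fact n) *\<^sub>R pow_deriv n [E] A) sums (E ** mat_exp A)"
    by (subst (asm) sums_Suc_iff) simp
qed

lemma mat_exp_scaleR_has_vector_derivative:
  "((\<lambda>t. mat_exp (t *\<^sub>R A)) has_vector_derivative A ** mat_exp (t *\<^sub>R A)) (at t)"
proof -
  have "((\<lambda>t. mat_exp (t *\<^sub>R A)) has_derivative (\<lambda>h. exp_deriv [h *\<^sub>R A] (t *\<^sub>R A))) (at t)"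
    by (rule has_derivative_compose [OF _ mat_exp_has_derivative]) (auto intro!: derivative_eq_intros)
  moreover have "exp_deriv [h *\<^sub>R A] (t *\<^sub>R A) = h *\<^sub>R (A ** mat_exp (t *\<^sub>R A))" for h
    by (simp add: exp_deriv_commute matrix_mult.scaleR_left matrix_mult.scaleR_right)
  ultimately show ?thesis by (simp add: has_vector_derivative_def)
qed

lemma mat_exp_commute: "mat_exp (t *\<^sub>R A) ** A = A ** mat_exp (t *\<^sub>R A)"
  by (rule mat_exp_intertwine) (simp add: matrix_mult.scaleR_left matrix_mult.scaleR_right)

lemma mat_exp_0: "mat_exp 0 = mat 1"
proof -
  have "mat_pow (0 :: real ^ 'a ^ 'a) n = 0" if "n > 0" for n
    using that by (cases n) (simp_all add: matrix_mult.zero_left)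
  then have "(\<lambda>n. (1 / fact n) *\<^sub>R mat_pow (0 :: real ^ 'a ^ 'a) n) = (\<lambda>n. if n = 0 then mat 1 else 0)"
    by auto
  then show ?thesis using mat_exp_sums [of "0 :: real ^ 'a ^ 'a"] sums_single [of 0 "\<lambda>_. mat 1 :: real ^ 'a ^ 'a"]
    by (metis (no_types, lifting) sums_unique2)
qed

lemma mat_exp_minus: "mat_exp (- A) ** mat_exp A = mat 1"
proof -
  let ?E = "\<lambda>t. mat_exp (t *\<^sub>R A)" and ?F = "\<lambda>t. mat_exp (t *\<^sub>R - A)"
  have "((\<lambda>t. ?F t ** ?E t) has_vector_derivative ?F t ** (A ** ?E t) + (- A ** ?F t) ** ?E t) (at t)" for t
    by (intro matrix_mult.has_vector_derivative mat_exp_scaleR_has_vector_derivative)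
  moreover have "?F t ** (A ** ?E t) + (- A ** ?F t) ** ?E t = 0" for t
    unfolding mat_exp_commute [of t "- A", symmetric]
    by (simp add: matrix_mult.minus_right matrix_mult.minus_left matrix_mul_assoc)
  ultimately have "((\<lambda>t. ?F t ** ?E t) has_derivative (\<lambda>h. 0)) (at t within UNIV)" for t
    by (simp add: has_vector_derivative_def)
  then have "?F 1 ** ?E 1 = ?F 0 ** ?E 0"
    by (intro has_derivative_zero_unique [OF convex_UNIV]) auto
  then show ?thesis by (simp add: mat_exp_0)
qed

lemma mat_exp_transpose: "mat_exp (transpose A) = transpose (mat_exp A)"
proof (rule sums_unique2 [OF mat_exp_sums])
  show "(\<lambda>n. (1 / fact n) *\<^sub>R mat_pow (transpose A) n) sums transpose (mat_exp A)"
    using bounded_linear.sums [OF bounded_linear_transpose mat_exp_sums, of A]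
    by (simp add: mat_pow_transpose transpose_scaleR)
qed

lemma mat_exp_skew:
  assumes "skew A"
  shows "transpose (mat_exp A) ** mat_exp A = mat 1" "mat_exp A ** transpose (mat_exp A) = mat 1"
  using mat_exp_minus [of A] mat_exp_minus [of "- A"] assms
  by (simp_all add: skew_def flip: mat_exp_transpose)

lemma linear_ode_solution:
  fixes F :: "real \<Rightarrow> real ^ 'p ^ 'n"
  assumes "\<And>t. (F has_vector_derivative A ** F t) (at t)"
  shows "F t = mat_exp (t *\<^sub>R A) ** F 0"
proof -
  let ?E = "\<lambda>t. mat_exp (t *\<^sub>R - A)"
  have "((\<lambda>t. ?E t ** F t) has_vector_derivative ?E t ** (A ** F t) + (- A ** ?E t) ** F t) (at t)" for t
    by (intro matrix_mult.has_vector_derivative mat_exp_scaleR_has_vector_derivative assms)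
  moreover have "?E t ** (A ** F t) + (- A ** ?E t) ** F t = 0" for t
    unfolding mat_exp_commute [of t "- A", symmetric]
    by (simp add: matrix_distribs matrix_mul_assoc)
  ultimately have "((\<lambda>t. ?E t ** F t) has_derivative (\<lambda>h. 0)) (at t within UNIV)" for t
    by (simp add: has_vector_derivative_def)
  then have "?E t ** F t = ?E 0 ** F 0"
    by (intro has_derivative_zero_unique [OF convex_UNIV]) auto
  then have "mat_exp (t *\<^sub>R A) ** (?E t ** F t) = mat_exp (t *\<^sub>R A) ** F 0"
    by (simp add: mat_exp_0)
  then show ?thesis
    using mat_exp_minus [of "t *\<^sub>R - A"] by (simp add: matrix_mul_assoc)
qed

section \<open>Existence of singular value decompositions\<close>

lemma compact_stiefel: "compact (stiefel :: (real ^ 'p ^ 'n) set)"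
  unfolding compact_eq_bounded_closed
proof
  have "norm V \<le> sqrt (trace (mat 1 :: real ^ 'p ^ 'p))" if "V \<in> stiefel" for V :: "real ^ 'p ^ 'n"
    using that by (simp add: norm_eq_sqrt_inner inner_trace stiefel_def)
  then show "bounded (stiefel :: (real ^ 'p ^ 'n) set)" unfolding bounded_iff by blast
  show "closed (stiefel :: (real ^ 'p ^ 'n) set)"
    unfolding stiefel_def
    by (intro closed_Collect_eq continuous_intros matrix_mult.continuous_on
        linear_continuous_on bounded_linear_transpose)
qed

text \<open>
  For a diagonal matrix \<open>N\<close> with distinct diagonal entries, let \<open>V\<close> maximise
  \<open>tr (V\<^sup>T G V N)\<close> over the orthogonal group. The derivative along \<open>t \<mapsto> V exp (t E)\<close> vanishes for
  every skew \<open>E\<close>, which says that \<open>H = V\<^sup>T G V\<close> commutes with \<open>N\<close>, so \<open>H\<close> is diagonal.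
\<close>

lemma symmetric_diagonalization:
  fixes G :: "real ^ 'p ^ 'p"
  assumes G: "transpose G = G"
  obtains V where "orthogonal_matrix V" "diagonal_mat (transpose V ** G ** V)"
proof -
  obtain w :: "'p \<Rightarrow> nat" where w: "inj w"
    using finite_imp_inj_to_nat_seg [OF finite [of "UNIV :: 'p set"]] by blast
  define N :: "real ^ 'p ^ 'p" where "N = (\<chi> i j. if i = j then real (w i) else 0)"
  have N: "transpose N = N" by (auto simp: N_def transpose_def vec_eq_iff)
  define f where "f = (\<lambda>V. (G ** V) \<bullet> (V ** N))"
  have cont: "continuous_on stiefel f"
    unfolding f_def by (intro continuous_intros matrix_mult.continuous_on)
  have "(mat 1 :: real ^ 'p ^ 'p) \<in> stiefel" by (simp add: stiefel_def)
  then have "stiefel \<noteq> ({} :: (real ^ 'p ^ 'p) set)" by blast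
  from continuous_attains_sup [OF compact_stiefel this cont]
  obtain V where V: "V \<in> stiefel" and max: "\<And>Y. Y \<in> stiefel \<Longrightarrow> f Y \<le> f V" by blast
  define H where "H = transpose V ** G ** V"
  have H: "transpose H = H" by (simp add: H_def matrix_transpose_mul G matrix_mul_assoc)
  \<comment> \<open>The derivative in a skew direction \<open>E\<close> turns out to be \<open>E \<bullet> (H N - N H)\<close>, which for this choice
    is \<open>\<parallel>H N - N H\<parallel>\<^sup>2\<close>.\<close>
  define E where "E = H ** N - N ** H"
  have E: "transpose E = - E" by (simp add: E_def transpose_diff matrix_transpose_mul H N)
  have der: "((\<lambda>t. f (V ** mat_exp (t *\<^sub>R E))) has_vector_derivative
      (G ** V) \<bullet> (V ** E ** N) + (G ** (V ** E)) \<bullet> (V ** N)) (at 0)"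
  proof -
    have d: "((\<lambda>t. V ** mat_exp (t *\<^sub>R E)) has_vector_derivative V ** E) (at 0)"
      using bounded_linear.has_vector_derivative [OF matrix_mult.bounded_linear_right
          mat_exp_scaleR_has_vector_derivative, of V E 0]
      by (simp add: mat_exp_0)
    show ?thesis
      using bounded_bilinear.has_vector_derivative [OF bounded_bilinear_inner
          bounded_linear.has_vector_derivative [OF matrix_mult.bounded_linear_right d, of G]
          bounded_linear.has_vector_derivative [OF matrix_mult.bounded_linear_left d, of N]]
      by (simp add: f_def mat_exp_0)
  qed
  have le: "f (V ** mat_exp (t *\<^sub>R E)) \<le> f (V ** mat_exp (0 *\<^sub>R E))" for t
  proof -
    have "skew (t *\<^sub>R E)"
      using E by (intro skew_scaleR) (simp add: skew_def)
    from mat_exp_skew(1) [OF this] V have "V ** mat_exp (t *\<^sub>R E) \<in> stiefel"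
      by (simp add: stiefel_def matrix_transpose_mul)
        (metis matrix_mul_assoc matrix_mul_rid)
    then show ?thesis using max by (simp add: mat_exp_0)
  qed
  have "(\<lambda>h :: real. h *\<^sub>R ((G ** V) \<bullet> (V ** E ** N) + (G ** (V ** E)) \<bullet> (V ** N))) = (\<lambda>h. 0)"
    by (rule differential_zero_maxmin [OF UNIV_I open_UNIV der [unfolded has_vector_derivative_def]])
      (use le in blast)
  from fun_cong [OF this, of 1]
  have "(G ** V) \<bullet> (V ** E ** N) + (G ** (V ** E)) \<bullet> (V ** N) = 0" by simp
  moreover have "(G ** V) \<bullet> (V ** E ** N) = - (E \<bullet> (N ** H))"
  proof -
    have "(G ** V) \<bullet> (V ** E ** N) = (V ** (E ** N)) \<bullet> (G ** V)"
      by (simp add: inner_commute matrix_mul_assoc)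
    also have "\<dots> = (E ** N) \<bullet> H" by (subst inner_matrix_left) (simp only: H_def matrix_mul_assoc)
    also have "\<dots> = transpose (E ** N) \<bullet> transpose H" by (simp only: inner_transpose)
    also have "\<dots> = (N ** - E) \<bullet> H" by (simp add: matrix_transpose_mul N E H)
    also have "\<dots> = - (E \<bullet> (N ** H))" by (simp add: inner_matrix_left N)
    finally show ?thesis .
  qed
  moreover have "(G ** (V ** E)) \<bullet> (V ** N) = E \<bullet> (H ** N)"
  proof -
    have "(G ** (V ** E)) \<bullet> (V ** N) = E \<bullet> (transpose (G ** V) ** (V ** N))"
      by (simp only: matrix_mul_assoc [of G] inner_matrix_left)
    also have "transpose (G ** V) ** (V ** N) = H ** N"
      by (simp add: H_def matrix_transpose_mul G matrix_mul_assoc)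
    finally show ?thesis .
  qed
  ultimately have "E \<bullet> E = 0" by (simp add: E_def inner_diff_right)
  then have "H ** N = N ** H" by (simp add: E_def)
  then have "(H ** N) $ i $ j = (N ** H) $ i $ j" for i j by simp
  then have *: "H $ i $ j * real (w j) = real (w i) * H $ i $ j" for i j
    by (simp add: matrix_matrix_mult_def N_def if_distrib [of "\<lambda>x. x * _"] if_distrib [of "\<lambda>x. _ * x"] cong: if_cong)
  have "diagonal_mat H"
    unfolding diagonal_mat_def
  proof (intro allI impI)
    fix i j :: 'p assume "i \<noteq> j"
    then have "w i \<noteq> w j" using w by (simp add: inj_eq)
    with * [of i j] show "H $ i $ j = 0" by auto
  qed
  then show ?thesis using that V by (simp add: H_def stiefel_def orthogonal_matrix)
qed

lemma stiefel_card_le: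
  fixes U :: "real ^ 'p ^ 'n"
  assumes "U \<in> stiefel"
  shows "CARD('p) \<le> CARD('n)"
proof -
  have "transpose U *v (U *v x) = x" for x
    using assms by (simp add: stiefel_def matrix_vector_mul_assoc del: transpose_matrix_vector)
  then have "inj ((*v) U)" by (metis injI)
  then have "dim (range ((*v) U)) = dim (UNIV :: (real ^ 'p) set)"
    by (intro dim_image_eq) (auto simp: inj_on_def inj_def)
  then show ?thesis using dim_subset_UNIV [of "range ((*v) U)"] by (simp add: dim_UNIV)
qed

text \<open>
  If \<open>V\<close> diagonalizes \<open>X\<^sup>T X\<close>, then the columns of \<open>X V\<close> are pairwise orthogonal and their norms are
  the singular values. The nonzero ones are normalized to columns of \<open>Q\<close>; the remaining columns of
  \<open>Q\<close> come from an orthogonal basis of the complement, which is large enough because \<open>p \<le> n\<close>.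
\<close>

lemma compact_svd_exists:
  fixes X :: "real ^ 'p ^ 'n"
  assumes "CARD('p) \<le> CARD('n)"
  obtains Q S V where "compact_svd X Q S V"
proof -
  obtain V where V: "orthogonal_matrix V" and dV: "diagonal_mat (transpose V ** (transpose X ** X) ** V)"
    using symmetric_diagonalization [of "transpose X ** X"] by (auto simp: matrix_transpose_mul)
  define Y where "Y = X ** V"
  define y where "y = (\<lambda>i. column i Y)"
  have "(transpose Y ** Y) $ i $ j = y i \<bullet> y j" for i j
    by (simp add: matrix_matrix_mult_def transpose_def y_def column_def inner_vec_def)
  moreover have "transpose Y ** Y = transpose V ** (transpose X ** X) ** V"
    by (simp add: Y_def matrix_transpose_mul matrix_mul_assoc)
  ultimately have orth: "orthogonal (y i) (y j)" if "i \<noteq> j" for i j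
    using dV that by (simp add: diagonal_mat_def orthogonal_def)
  define I where "I = {i. y i \<noteq> 0}"
  have inj: "inj_on y I"
    using orth by (auto simp: inj_on_def I_def) (metis orthogonal_self)
  have "pairwise orthogonal (y ` I)"
    using orth by (auto simp: pairwise_def) metis
  from orthogonal_extension_strong [OF this, of UNIV] obtain K where
    K: "K \<inter> insert 0 (y ` I) = {}" "pairwise orthogonal (y ` I \<union> K)" "span (y ` I \<union> K) = UNIV"
    by auto
  have K0: "0 \<notin> y ` I \<union> K" using K(1) by (auto simp: I_def)
  then have ind: "independent (y ` I \<union> K)" using K(2) pairwise_orthogonal_independent by blast
  then have fin: "finite (y ` I \<union> K)" by (rule independent_imp_finite)
  have "CARD('n) = card (y ` I \<union> K)"
    using dim_eq_card [OF _ ind, of UNIV] K(3) by (simp add: dim_UNIV)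
  also have "\<dots> = card I + card K"
    using fin K(1) by (subst card_Un_disjoint) (auto simp: card_image inj)
  finally have "card (- I) \<le> card K"
    using assms by (simp add: Compl_eq_Diff_UNIV card_Diff_subset)
  then obtain g where g: "inj_on g (- I)" "g ` (- I) \<subseteq> K"
    using fin by (metis card_le_inj finite finite_Un)
  define r where "r = (\<lambda>i. if i \<in> I then y i else g i)"
  have rK: "r i \<in> y ` I \<union> K" for i using g(2) by (auto simp: r_def)
  then have r0: "r i \<noteq> 0" for i using K0 by metis
  have "r i \<noteq> r j" if "i \<noteq> j" for i j
  proof -
    have "y k \<noteq> g l" if "k \<in> I" "l \<notin> I" for k l using that g(2) K(1) by blast
    then show ?thesis
      using that inj_onD [OF inj, of i j] inj_onD [OF g(1), of i j]
      by (cases "i \<in> I"; cases "j \<in> I") (auto simp: r_def dest: sym)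
  qed
  then have ro: "r i \<bullet> r j = 0" if "i \<noteq> j" for i j
    using that K(2) rK by (auto simp: pairwise_def orthogonal_def)
  define Q :: "real ^ 'p ^ 'n" where "Q = (\<chi> k i. (r i /\<^sub>R norm (r i)) $ k)"
  define S :: "real ^ 'p ^ 'p" where "S = (\<chi> i j. if i = j then norm (y i) else 0)"
  have "(transpose Q ** Q) $ i $ j = (r i /\<^sub>R norm (r i)) \<bullet> (r j /\<^sub>R norm (r j))" for i j
    by (simp add: matrix_matrix_mult_def transpose_def Q_def inner_vec_def)
  moreover have "(r i /\<^sub>R norm (r i)) \<bullet> (r j /\<^sub>R norm (r j)) = (mat 1 :: real ^ 'p ^ 'p) $ i $ j" for i j
  proof (cases "i = j")
    case True
    have "norm (r i /\<^sub>R norm (r i)) = 1" using r0 by simp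
    then show ?thesis using True by (simp only: norm_eq_1) (simp add: mat_def)
  next
    case False
    then show ?thesis using ro by (simp add: mat_def)
  qed
  ultimately have "Q \<in> stiefel" by (simp add: stiefel_def vec_eq_iff)
  moreover have "Q ** S = Y"
  proof -
    have "(Q ** S) $ k $ i = Q $ k $ i * norm (y i)" for k i
      by (simp add: matrix_matrix_mult_def S_def if_distrib [of "\<lambda>x. _ * x"] cong: if_cong)
    moreover have "Q $ k $ i * norm (y i) = y i $ k" for k i
      by (cases "i \<in> I") (auto simp: Q_def r_def I_def)
    ultimately show ?thesis by (simp add: vec_eq_iff y_def column_def)
  qed
  then have "Q ** S ** transpose V = X"
    using V by (simp add: Y_def orthogonal_matrix_def flip: matrix_mul_assoc)
  ultimately have "compact_svd X Q S V"
    using V by (simp add: compact_svd_def) (simp add: diagonal_mat_def S_def)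
  then show ?thesis by (rule that)
qed

section \<open>The retraction in terms of matrix exponentials\<close>

text \<open>
  The skew-symmetric \<open>n \<times> n\<close> matrix \<open>X U\<^sup>T - U X\<^sup>T\<close> with \<open>X = (I - U U\<^sup>T) D\<close> the normal part of \<open>D\<close>.
  Its one-parameter group rotates \<open>U\<close> in the direction \<open>X\<close>.
\<close>

definition stiefel_rot :: "real ^ 'p ^ 'n \<Rightarrow> real ^ 'p ^ 'n \<Rightarrow> real ^ 'n ^ 'n" where
  "stiefel_rot U D = (mat 1 - U ** transpose U) ** D ** transpose U
     - U ** transpose ((mat 1 - U ** transpose U) ** D)"

text \<open>
  A smooth map on all pairs of matrices that agrees with \<open>stiefel_RS\<close> on the tangent bundle.
\<close>

definition stiefel_RS_exp :: "real ^ 'p ^ 'n \<Rightarrow> real ^ 'p ^ 'n \<Rightarrow> real ^ 'p ^ 'n" where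
  "stiefel_RS_exp U D = mat_exp (stiefel_rot U D) ** U ** mat_exp (transpose U ** D)"

lemma skew_stiefel_rot: "skew (stiefel_rot U D)"
  by (simp add: skew_def stiefel_rot_def matrix_distribs)

lemma stiefel_rot_scaleR: "stiefel_rot U (t *\<^sub>R D) = t *\<^sub>R stiefel_rot U D"
  by (simp add: stiefel_rot_def matrix_distribs scaleR_diff_right)

lemma diag_map_nth: "diag_map f T $ i $ j = (if i = j then f (T $ i $ i) else 0)"
  by (simp add: diag_map_def)

lemma matrix_mult_diag_map_nth: "(M ** diag_map f T) $ i $ j = M $ i $ j * f (T $ j $ j)"
  by (simp add: matrix_matrix_mult_def diag_map_def if_distrib [of "\<lambda>x. _ * x"] cong: if_cong)

text \<open>
  Both sides of the following identity solve \<open>F' = \<Omega> F\<close>, \<open>F 0 = U\<close> for \<open>\<Omega> = stiefel_rot U D\<close>. Columns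
  of \<open>Q\<close> belonging to zero singular values need not be orthogonal to \<open>U\<close>, but they are multiplied
  by \<open>sin 0 = 0\<close>.
\<close>

lemma mat_exp_stiefel_rot_svd:
  assumes U: "U \<in> stiefel"
    and svd: "compact_svd ((mat 1 - U ** transpose U) ** D) Q S V"
  shows "mat_exp (t *\<^sub>R stiefel_rot U D) ** U =
    (U ** V ** diag_map cos (t *\<^sub>R S) + Q ** diag_map sin (t *\<^sub>R S)) ** transpose V"
proof -
  define X where "X = (mat 1 - U ** transpose U) ** D"
  have UU: "transpose U ** U = mat 1" using U by (simp add: stiefel_def)
  have QQ: "transpose Q ** Q = mat 1" and dS: "diagonal_mat S"
    and V: "transpose V ** V = mat 1" "V ** transpose V = mat 1"
    and X: "X = Q ** S ** transpose V"
    using svd by (auto simp: compact_svd_def stiefel_def orthogonal_matrix_def X_def)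
  have St: "transpose S = S" using dS by (auto simp: transpose_def diagonal_mat_def vec_eq_iff) metis
  have UX: "transpose U ** X = 0"
    by (simp add: X_def matrix_distribs matrix_mul_assoc UU)
  then have XU: "transpose X ** U = 0"
    by (metis matrix_transpose_mul transpose_transpose transpose_zero)
  have XV: "X ** V = Q ** S"
    by (simp add: X V flip: matrix_mul_assoc)
  have XQ: "transpose X ** Q = V ** S"
    by (simp add: X matrix_distribs St QQ flip: matrix_mul_assoc)
  have UQS: "transpose U ** Q ** S = 0"
    using UX by (simp add: matrix_distribs flip: XV matrix_mul_assoc) (simp add: matrix_mul_assoc matrix_distribs)
  have S: "S = diag_map (\<lambda>x. x) S"
    using dS by (auto simp: diag_map_def diagonal_mat_def vec_eq_iff)
  have UQs: "transpose U ** Q ** diag_map sin (t *\<^sub>R S) = 0" for t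
  proof -
    have "(transpose U ** Q) $ i $ j * S $ j $ j = 0" for i j
    proof -
      have "(transpose U ** Q ** diag_map (\<lambda>x. x) S) $ i $ j = 0" using UQS S by simp
      then show ?thesis by (simp only: matrix_mult_diag_map_nth)
    qed
    then have "(transpose U ** Q) $ i $ j * sin (t * S $ j $ j) = 0" for i j
      by (metis mult_eq_0_iff sin_zero)
    then show ?thesis by (simp add: vec_eq_iff matrix_mult_diag_map_nth)
  qed
  let ?c = "\<lambda>t. diag_map cos (t *\<^sub>R S)" and ?s = "\<lambda>t. diag_map sin (t *\<^sub>R S)"
  have Sm: "(S ** diag_map f T) $ i $ j = (if i = j then S $ i $ i * f (T $ i $ i) else 0)" for f T i j
    using dS by (auto simp: matrix_mult_diag_map_nth diagonal_mat_def)
  have dc: "(?c has_vector_derivative - (S ** ?s t)) (at t)"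
    and ds: "(?s has_vector_derivative S ** ?c t) (at t)" for t
    by (auto simp: Sm diag_map_nth intro!: has_vector_derivative_matrix derivative_eq_intros)
  define F where "F = (\<lambda>t. (U ** V ** ?c t + Q ** ?s t) ** transpose V)"
  have "(F has_vector_derivative stiefel_rot U D ** F t) (at t)" for t
  proof -
    have "(F has_vector_derivative (U ** V ** - (S ** ?s t) + Q ** (S ** ?c t)) ** transpose V) (at t)"
      unfolding F_def
      by (intro bounded_linear.has_vector_derivative [OF matrix_mult.bounded_linear_left]
          has_vector_derivative_add dc ds
          bounded_linear.has_vector_derivative [OF matrix_mult.bounded_linear_right])
    moreover have "stiefel_rot U D ** F t = (U ** V ** - (S ** ?s t) + Q ** (S ** ?c t)) ** transpose V"
    proof -
      have "stiefel_rot U D ** F t = (X ** (transpose U ** U) ** V ** ?c t + X ** (transpose U ** Q ** ?s t)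
          - U ** (transpose X ** U) ** V ** ?c t - U ** (transpose X ** Q) ** ?s t) ** transpose V"
        unfolding F_def stiefel_rot_def X_def [symmetric]
        by (simp add: matrix_distribs matrix_mul_assoc algebra_simps)
      also have "\<dots> = (X ** V ** ?c t - U ** (V ** S) ** ?s t) ** transpose V"
        by (simp add: UU UQs XU XQ matrix_distribs)
      also have "\<dots> = (U ** V ** - (S ** ?s t) + Q ** (S ** ?c t)) ** transpose V"
        by (simp add: XV matrix_distribs matrix_mul_assoc)
      finally show ?thesis .
    qed
    ultimately show ?thesis by simp
  qed
  then have "F t = mat_exp (t *\<^sub>R stiefel_rot U D) ** F 0" by (rule linear_ode_solution)
  moreover have "F 0 = U"
  proof -
    have "?c 0 = mat 1" "?s 0 = 0" by (auto simp: diag_map_def mat_def vec_eq_iff)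
    then show ?thesis using V by (simp add: F_def matrix_distribs flip: matrix_mul_assoc)
  qed
  ultimately show ?thesis by (simp add: F_def)
qed

lemma tangent_coords_skew_part:
  assumes "orth_completion J U W" "tangent_coords J U W A B D"
  shows "transpose U ** D = A"
  using assms by (simp add: orth_completion_iff tangent_coords_def stiefel_def matrix_distribs matrix_mul_assoc)

lemma stiefel_RS_eq_exp:
  fixes U :: "real ^ 'p ^ 'n"
  assumes U: "U \<in> stiefel" and D: "D \<in> stiefel_tangent U"
  shows "stiefel_RS U D = stiefel_RS_exp U D"
  unfolding stiefel_RS_def
proof (rule the_equality)
  have svd: "(U ** V ** diag_map cos S + Q ** diag_map sin S) ** transpose V ** mat_exp (transpose U ** D)
      = stiefel_RS_exp U D"
    if "compact_svd ((mat 1 - U ** transpose U) ** D) Q S V" for Q S V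
    using mat_exp_stiefel_rot_svd [OF U that, of 1] by (simp add: stiefel_RS_exp_def)
  obtain J :: "'n set" and W A B where 1: "orth_completion J U W" "tangent_coords J U W A B D"
    using D by (auto simp: stiefel_tangent_def)
  obtain Q S V where 2: "compact_svd ((mat 1 - U ** transpose U) ** D) Q S V"
    using compact_svd_exists [OF stiefel_card_le [OF U]] by blast
  show "\<exists>(J :: 'n set) W A B Q S V.
     orth_completion J U W \<and> tangent_coords J U W A B D \<and>
     compact_svd ((mat 1 - U ** transpose U) ** D) Q S V \<and>
     stiefel_RS_exp U D = (U ** V ** diag_map cos S + Q ** diag_map sin S) ** transpose V ** mat_exp A"
    using 1 2 svd [OF 2] tangent_coords_skew_part [OF 1] by metis
  fix Y
  assume Y: "\<exists>(J :: 'n set) W A B Q S V.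
     orth_completion J U W \<and> tangent_coords J U W A B D \<and>
     compact_svd ((mat 1 - U ** transpose U) ** D) Q S V \<and>
     Y = (U ** V ** diag_map cos S + Q ** diag_map sin S) ** transpose V ** mat_exp A"
  from Y obtain J :: "'n set" and W A B Q S V where
    "orth_completion J U W" "tangent_coords J U W A B D"
    and c: "compact_svd ((mat 1 - U ** transpose U) ** D) Q S V"
    and Y': "Y = (U ** V ** diag_map cos S + Q ** diag_map sin S) ** transpose V ** mat_exp A"
    by blast
  then have "transpose U ** D = A" by (intro tangent_coords_skew_part)
  with svd [OF c] Y' show "Y = stiefel_RS_exp U D" by simp
qed

lemma stiefel_RS_exp_in_stiefel:
  assumes U: "U \<in> stiefel" and D: "D \<in> stiefel_tangent U"
  shows "stiefel_RS_exp U D \<in> stiefel"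
proof -
  have "skew (transpose U ** D)" using D by (simp add: stiefel_tangent_iff [OF U])
  note e = mat_exp_skew(1) [OF skew_stiefel_rot [of U D]] mat_exp_skew(1) [OF this]
  have "transpose U ** U = mat 1" using U by (simp add: stiefel_def)
  note c = matrix_mul_cancel [OF e(1)] matrix_mul_cancel [OF this]
  show ?thesis
    by (simp add: stiefel_RS_exp_def stiefel_def matrix_transpose_mul e c flip: matrix_mul_assoc)
qed

lemma C_diff_on_stiefel_RS_exp:
  "C_diff_on k UNIV (\<lambda>(U :: real ^ 'p ^ 'n, D). stiefel_RS_exp U D)"
proof -
  have t: "C_diff_on k UNIV (\<lambda>x. transpose (f x))" if "C_diff_on k UNIV f"
    for f :: "'a::euclidean_space \<Rightarrow> real ^ 'b ^ 'c"
    using C_diff_on_bounded_linear_compose [OF open_UNIV that bounded_linear_transpose] .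
  have d: "C_diff_on k UNIV (\<lambda>x. f x - g x)" if "C_diff_on k UNIV f" "C_diff_on k UNIV g"
    for f g :: "'a::euclidean_space \<Rightarrow> 'b::euclidean_space"
    using C_diff_on_add [OF open_UNIV that(1)
        C_diff_on_bounded_linear_compose [OF open_UNIV that(2) bounded_linear_minus [OF bounded_linear_ident]]]
    by simp
  have e: "C_diff_on k UNIV (\<lambda>x. mat_exp (f x))" if "C_diff_on k UNIV f"
    for f :: "'a::euclidean_space \<Rightarrow> real ^ 'b ^ 'b"
    using C_diff_on_compose [OF open_UNIV open_UNIV _ that C_diff_on_mat_exp [OF open_UNIV]] by simp
  have l: "C_diff_on k UNIV fst" "C_diff_on k UNIV snd"
    by (simp_all add: C_diff_on_bounded_linear bounded_linear_fst bounded_linear_snd)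
  show ?thesis
    unfolding split_beta stiefel_RS_exp_def stiefel_rot_def
    by (intro l t d e C_diff_on_matrix_mult C_diff_on_const open_UNIV)
qed

lemma stiefel_RS_exp_has_derivative:
  assumes "U \<in> stiefel"
  shows "(stiefel_RS_exp U has_derivative (\<lambda>D. D)) (at 0)"
proof -
  have lin: "bounded_linear (stiefel_rot U)"
    by (rule linear_conv_bounded_linear [THEN iffD1], rule linearI)
      (simp_all add: stiefel_rot_def matrix_distribs algebra_simps)
  have [simp]: "exp_deriv [E] 0 = E" for E :: "real ^ 'c ^ 'c"
    by (subst exp_deriv_commute) (simp_all add: mat_exp_0 matrix_distribs)
  have d: "((\<lambda>D. mat_exp (f D)) has_derivative f) (at 0)" if "bounded_linear f"
    for f :: "real ^ 'a ^ 'b \<Rightarrow> real ^ 'c ^ 'c"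
  proof -
    have "f 0 = 0" using that by (simp add: linear_simps)
    then show ?thesis
      using has_derivative_compose [OF bounded_linear_imp_has_derivative [OF that, of "at 0"] mat_exp_has_derivative]
      by simp
  qed
  have "(stiefel_RS_exp U has_derivative
      (\<lambda>D. mat_exp (stiefel_rot U 0) ** U ** (transpose U ** D)
        + stiefel_rot U D ** U ** mat_exp (transpose U ** 0))) (at 0)"
    unfolding stiefel_RS_exp_def [abs_def]
    by (intro matrix_mult.FDERIV d lin matrix_mult.bounded_linear_right
        bounded_linear.has_derivative [OF matrix_mult.bounded_linear_left])
  moreover have "mat_exp (stiefel_rot U 0) ** U ** (transpose U ** D)
        + stiefel_rot U D ** U ** mat_exp (transpose U ** 0) = D" for D
  proof -
    have UU: "transpose U ** U = mat 1" using assms by (simp add: stiefel_def)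
    note c = matrix_mul_cancel [OF UU]
    show ?thesis
      by (simp add: stiefel_rot_def matrix_distribs mat_exp_0 UU c flip: matrix_mul_assoc)
  qed
  ultimately show ?thesis by simp
qed

lemma zero_in_stiefel_tangent: "U \<in> stiefel \<Longrightarrow> 0 \<in> stiefel_tangent U"
  by (simp add: stiefel_tangent_iff skew_def matrix_distribs)

lemma is_retraction_stiefel_RS:
  "is_retraction stiefel stiefel_tangent (stiefel_RS :: real ^ 'p ^ 'n \<Rightarrow> real ^ 'p ^ 'n \<Rightarrow> real ^ 'p ^ 'n)"
  unfolding is_retraction_def
proof (intro conjI ballI)
  fix U :: "real ^ 'p ^ 'n"
  assume U: "U \<in> stiefel"
  show "stiefel_RS U D \<in> stiefel" if "D \<in> stiefel_tangent U" for D
    using stiefel_RS_exp_in_stiefel [OF U that] by (simp add: stiefel_RS_eq_exp [OF U that])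
  show "stiefel_RS U 0 = U"
    by (simp add: stiefel_RS_eq_exp U zero_in_stiefel_tangent stiefel_RS_exp_def stiefel_rot_def
        matrix_distribs mat_exp_0)
  show "(stiefel_RS U has_derivative (\<lambda>v. v)) (at 0 within stiefel_tangent U)"
    by (rule has_derivative_transform [OF zero_in_stiefel_tangent [OF U] stiefel_RS_eq_exp [OF U]
        has_derivative_at_withinI [OF stiefel_RS_exp_has_derivative [OF U]]])
next
  show "smooth_on (tangent_bundle stiefel stiefel_tangent)
      (\<lambda>(U, D). stiefel_RS U (D :: real ^ 'p ^ 'n))"
    unfolding smooth_on_def
    by (intro ballI exI [of _ UNIV] exI [of _ "\<lambda>(U, D). stiefel_RS_exp U D"])
      (auto simp: C_diff_on_stiefel_RS_exp tangent_bundle_def stiefel_RS_eq_exp)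
qed

section \<open>The curve and its orthogonal completion\<close>

lemma stiefel_rot_coords:
  assumes "orth_completion J U W" "tangent_coords J U W A B D"
  shows "stiefel_rot U D = W ** B ** transpose U - U ** transpose (W ** B)"
proof -
  have "transpose U ** U = mat 1" "transpose U ** W = 0" and D: "D = U ** A + W ** B"
    using assms by (auto simp: orth_completion_iff tangent_coords_def stiefel_def)
  then have "(mat 1 - U ** transpose U) ** D = W ** B"
    by (simp add: D matrix_distribs matrix_mul_cancel flip: matrix_mul_assoc)
  then show ?thesis by (simp add: stiefel_rot_def)
qed

lemma stiefel_rot_mult:
  assumes "orth_completion J U W" "tangent_coords J U W A B D"
  shows "stiefel_rot U D ** U = W ** B" "stiefel_rot U D ** W = - (U ** transpose B)"
proof -
  have UU: "transpose U ** U = mat 1" and UW: "transpose U ** W = 0" and WW: "transpose W ** W = mat_on J"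
    and B: "B \<in> rows_on J"
    using assms by (auto simp: orth_completion_iff tangent_coords_def stiefel_def)
  have WU: "transpose W ** U = 0"
    using arg_cong [OF UW, of transpose] by (simp add: matrix_distribs)
  have BJ: "transpose B ** mat_on J = transpose B" using B by (intro mult_mat_on transpose_rows_on)
  show "stiefel_rot U D ** U = W ** B" "stiefel_rot U D ** W = - (U ** transpose B)"
    unfolding stiefel_rot_coords [OF assms]
    by (simp_all add: matrix_distribs UU UW WU WW BJ flip: matrix_mul_assoc)
qed

lemma mat_exp_block:
  assumes "orth_completion J U W" "tangent_coords J U W A B D"
  shows "hcat U W ** mat_exp (t *\<^sub>R vcat (hcat 0 (- transpose B)) (hcat B 0)) ** vcat 0 (mat_on J)
    = mat_exp (t *\<^sub>R stiefel_rot U D) ** W"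
proof -
  let ?M = "vcat (hcat 0 (- transpose B)) (hcat B 0)"
  have "stiefel_rot U D ** hcat U W = hcat U W ** ?M"
    by (simp add: matrix_mult_hcat hcat_mult_vcat hcat_add stiefel_rot_mult [OF assms] matrix_distribs)
  then have "mat_exp (t *\<^sub>R stiefel_rot U D) ** hcat U W = hcat U W ** mat_exp (t *\<^sub>R ?M)"
    by (intro mat_exp_intertwine) (simp add: matrix_distribs)
  then have "hcat U W ** mat_exp (t *\<^sub>R ?M) ** vcat 0 (mat_on J)
      = mat_exp (t *\<^sub>R stiefel_rot U D) ** (hcat U W ** vcat 0 (mat_on J))"
    by (simp add: matrix_mul_assoc)
  also have "hcat U W ** vcat 0 (mat_on J) = W"
    using assms(1) by (simp add: hcat_mult_vcat matrix_distribs mult_mat_on orth_completion_iff)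
  finally show ?thesis .
qed

lemma orth_completion_rotate:
  assumes "orth_completion J U W" "orthogonal_matrix E" "orthogonal_matrix e"
  shows "orth_completion J (E ** U ** e) (E ** W)"
proof -
  have UU: "transpose U ** U = mat 1" and UW: "transpose U ** W = 0" and WW: "transpose W ** W = mat_on J"
    and e: "U ** transpose U + W ** transpose W = mat 1" and W: "W \<in> cols_on J"
    using assms(1) by (auto simp: orth_completion_iff stiefel_def)
  have o: "transpose E ** E = mat 1" "E ** transpose E = mat 1" "transpose e ** e = mat 1" "e ** transpose e = mat 1"
    using assms by (auto simp: orthogonal_matrix_def)
  note c = o [THEN matrix_mul_cancel] UU [THEN matrix_mul_cancel] UW [THEN matrix_mul_cancel]
  have "E ** U ** e ** transpose (E ** U ** e) + E ** W ** transpose (E ** W)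
      = E ** (U ** transpose U + W ** transpose W) ** transpose E"
    by (simp add: matrix_distribs c flip: matrix_mul_assoc)
  moreover have "E ** W \<in> cols_on J"
    using W by (auto simp: cols_on_def matrix_matrix_mult_def)
  ultimately show ?thesis
    unfolding orth_completion_iff stiefel_def e
    by (simp add: matrix_distribs c o UW WW flip: matrix_mul_assoc)
qed

lemma smooth_on_stiefel_curve:
  fixes U :: "real ^ 'p ^ 'n"
  shows "smooth_on UNIV (\<lambda>t. mat_exp (t *\<^sub>R R) ** U ** mat_exp (t *\<^sub>R A))"
proof -
  have e: "C_diff_on k UNIV (\<lambda>t. mat_exp (t *\<^sub>R M))" for k and M :: "real ^ 'b ^ 'b"
    using C_diff_on_compose [OF open_UNIV open_UNIV _
        C_diff_on_bounded_linear [OF open_UNIV bounded_linear_scaleR_left] C_diff_on_mat_exp [OF open_UNIV]]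
    by simp
  have "C_diff_on k UNIV (\<lambda>t. mat_exp (t *\<^sub>R R) ** U ** mat_exp (t *\<^sub>R A))" for k
    by (intro C_diff_on_matrix_mult e C_diff_on_const open_UNIV)
  then show ?thesis unfolding smooth_on_def by blast
qed

theorem proposition1:
  fixes U D Q :: "real ^ 'p ^ 'n"
    and J :: "'m::finite set"
    and W :: "real ^ 'm ^ 'n"
    and A S V :: "real ^ 'p ^ 'p"
    and B :: "real ^ 'p ^ 'm"
  assumes "U \<in> stiefel"
    and "card J = CARD('n) - CARD('p)"
    and "orth_completion J U W"
    and "skew A" and "B \<in> rows_on J"
    and "D = U ** A + W ** B"
    and "compact_svd ((mat 1 - U ** transpose U) ** D) Q S V"
  shows
    "is_retraction stiefel stiefel_tangent
       (stiefel_RS :: real ^ 'p ^ 'n \<Rightarrow> real ^ 'p ^ 'n \<Rightarrow> real ^ 'p ^ 'n) \<and>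
     (let \<gamma> = (\<lambda>t. stiefel_RS U (t *\<^sub>R D));
          \<gamma>p = (\<lambda>t. hcat U W
                    ** mat_exp (t *\<^sub>R vcat (hcat 0 (- transpose B)) (hcat B 0))
                    ** vcat 0 (mat_on J))
      in is_quasi_geodesic stiefel stiefel_tangent stiefel_metric \<gamma> \<and>
         (\<forall>t. \<gamma> t = (U ** V ** diag_map cos (t *\<^sub>R S) + Q ** diag_map sin (t *\<^sub>R S))
                    ** transpose V ** mat_exp (t *\<^sub>R A)) \<and>
         (\<forall>t. orth_completion J (\<gamma> t) (\<gamma>p t)) \<and>
         \<gamma> 0 = U \<and>
         (\<forall>t. (\<gamma> has_vector_derivative \<gamma> t ** A + \<gamma>p t ** B ** mat_exp (t *\<^sub>R A)) (at t)) \<and>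
         (\<forall>t. (metric_norm stiefel_metric (\<gamma> t) (velocity \<gamma> t))\<^sup>2
                = 1/2 * trace (transpose A ** A) + trace (transpose B ** B)) \<and>
         (\<forall>t. (velocity \<gamma> has_vector_derivative
                 \<gamma> t ** (A ** A - mat_exp (t *\<^sub>R transpose A) ** transpose B ** B ** mat_exp (t *\<^sub>R A))
                 + 2 *\<^sub>R (\<gamma>p t ** B ** A ** mat_exp (t *\<^sub>R A))) (at t)) \<and>
         (\<forall>t. covariant_acceleration stiefel_tangent stiefel_metric \<gamma> t
                = \<gamma>p t ** B ** A ** mat_exp (t *\<^sub>R A)) \<and>
         (\<forall>t. (metric_norm stiefel_metric (\<gamma> t)
                 (covariant_acceleration stiefel_tangent stiefel_metric \<gamma> t))\<^sup>2
                = (norm (B ** A))\<^sup>2) \<and>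
         (is_geodesic stiefel stiefel_tangent stiefel_metric \<gamma> \<longleftrightarrow> B ** A = 0))"
proof -
  note U = assms(1) and UW = assms(3) and A = assms(4) and B = assms(5)
  have coords: "tangent_coords J U W A B D" using assms by (simp add: tangent_coords_def)
  define R where "R = stiefel_rot U D"
  define E where "E = (\<lambda>t. mat_exp (t *\<^sub>R R))"
  define e where "e = (\<lambda>t. mat_exp (t *\<^sub>R A))"
  define \<gamma> where "\<gamma> = (\<lambda>t. stiefel_RS U (t *\<^sub>R D))"
  define \<gamma>p where "\<gamma>p = (\<lambda>t. hcat U W
                    ** mat_exp (t *\<^sub>R vcat (hcat 0 (- transpose B)) (hcat B 0))
                    ** vcat 0 (mat_on J))"
  have UD: "transpose U ** D = A" by (rule tangent_coords_skew_part [OF UW coords])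
  have tD: "t *\<^sub>R D \<in> stiefel_tangent U" for t
    by (simp add: stiefel_tangent_iff [OF U] matrix_mult.scaleR_right UD skew_scaleR A)
  have \<gamma>: "\<gamma> t = E t ** U ** e t" for t
    by (simp add: \<gamma>_def stiefel_RS_eq_exp [OF U tD] stiefel_RS_exp_def stiefel_rot_scaleR
        matrix_mult.scaleR_right UD E_def e_def R_def)
  have \<gamma>p: "\<gamma>p t = E t ** W" for t
    by (simp add: \<gamma>p_def mat_exp_block [OF UW coords] E_def R_def)
  have RU: "R ** U = W ** B" and RW: "R ** W = - (U ** transpose B)"
    unfolding R_def by (fact stiefel_rot_mult [OF UW coords])+
  have ER: "R ** E t = E t ** R" and eA: "e t ** A = A ** e t" for t
    by (simp_all add: E_def e_def mat_exp_commute)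
  have dE: "(E has_vector_derivative E t ** R) (at t)" for t
    unfolding ER [symmetric] unfolding E_def by (rule mat_exp_scaleR_has_vector_derivative)
  have de: "(e has_vector_derivative A ** e t) (at t)" for t
    unfolding e_def by (rule mat_exp_scaleR_has_vector_derivative)
  have oE: "orthogonal_matrix (E t)" and oe: "orthogonal_matrix (e t)" for t
    by (simp_all add: E_def e_def R_def orthogonal_matrix mat_exp_skew skew_scaleR skew_stiefel_rot A)
  have orth: "orth_completion J (\<gamma> t) (\<gamma>p t)" for t
    unfolding \<gamma> \<gamma>p by (rule orth_completion_rotate [OF UW oE oe])
  have ee: "transpose (e t) ** e t = mat 1" "e t ** transpose (e t) = mat 1" for t
    using oe by (auto simp: orthogonal_matrix_def)
  have At: "transpose A = - A" using A by (simp add: skew_def)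
  have BJ: "mat_on J ** B = B" using B by (rule mat_on_mult)
  have gg: "transpose (\<gamma> t) ** \<gamma> t = mat 1" and gp: "transpose (\<gamma> t) ** \<gamma>p t = 0"
    and pp: "transpose (\<gamma>p t) ** \<gamma>p t = mat_on J" and St: "\<gamma> t \<in> stiefel" for t
    using orth [of t] by (auto simp: orth_completion_iff stiefel_def)
  have pg: "transpose (\<gamma>p t) ** \<gamma> t = 0" for t
    using arg_cong [OF gp [of t], of transpose] by (simp add: matrix_distribs)
  note cancel = gg [THEN matrix_mul_cancel] gp [THEN matrix_mul_cancel] pp [THEN matrix_mul_cancel]
    pg [THEN matrix_mul_cancel] ee [THEN matrix_mul_cancel] BJ [THEN matrix_mul_cancel]
  define v where "v = (\<lambda>t. \<gamma> t ** A + \<gamma>p t ** B ** e t)"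
  define a where "a = (\<lambda>t. \<gamma> t ** (A ** A - transpose (e t) ** transpose B ** B ** e t)
    + 2 *\<^sub>R (\<gamma>p t ** B ** A ** e t))"
  define acc where "acc = (\<lambda>t. \<gamma>p t ** B ** A ** e t)"

  \<comment> \<open>Both derivatives use \<open>R U = W B\<close> and \<open>R W = - U B\<^sup>T\<close>.\<close>
  have dp: "(\<gamma>p has_vector_derivative - (E t ** U ** transpose B)) (at t)" for t
  proof -
    have "(\<gamma>p has_vector_derivative E t ** R ** W) (at t)"
      unfolding \<gamma>p [abs_def]
      by (rule bounded_linear.has_vector_derivative [OF matrix_mult.bounded_linear_left dE])
    then show ?thesis by (simp add: RW matrix_distribs flip: matrix_mul_assoc)
  qed
  have dg: "(\<gamma> has_vector_derivative v t) (at t)" for t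
  proof -
    have "(\<gamma> has_vector_derivative E t ** U ** (A ** e t) + E t ** R ** U ** e t) (at t)"
      unfolding \<gamma> [abs_def]
      by (intro matrix_mult.has_vector_derivative de
          bounded_linear.has_vector_derivative [OF matrix_mult.bounded_linear_left] dE)
    moreover have "E t ** U ** (A ** e t) + E t ** R ** U ** e t = v t"
      by (simp add: v_def \<gamma> \<gamma>p eA RU matrix_mul_cancel [OF RU] flip: matrix_mul_assoc)
    ultimately show ?thesis by simp
  qed
  then have vel: "velocity \<gamma> t = v t" for t by (rule vector_derivative_at)
  have dv: "(v has_vector_derivative a t) (at t)" for t
  proof -
    have "(v has_vector_derivative v t ** A +
        (\<gamma>p t ** B ** (A ** e t) + - (E t ** U ** transpose B) ** B ** e t)) (at t)"
      unfolding v_def [abs_def]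
      by (intro has_vector_derivative_add matrix_mult.has_vector_derivative de dp
          bounded_linear.has_vector_derivative [OF matrix_mult.bounded_linear_left] dg [unfolded v_def])
    moreover have "v t ** A + (\<gamma>p t ** B ** (A ** e t) + - (E t ** U ** transpose B) ** B ** e t) = a t"
      by (simp add: v_def a_def eA matrix_mul_cancel [OF eA] \<gamma> cancel matrix_distribs scaleR_2 flip: matrix_mul_assoc)
    ultimately show ?thesis by simp
  qed
  then have vel2: "velocity v t = a t" for t by (rule vector_derivative_at)
  have smooth: "is_smooth_curve stiefel \<gamma>"
    using smooth_on_stiefel_curve [of R U A] St
    by (auto simp: is_smooth_curve_def \<gamma> [abs_def] E_def e_def)
  have gv: "transpose (\<gamma> t) ** v t = A" for t
    by (simp add: v_def matrix_distribs cancel flip: matrix_mul_assoc)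
  have gv': "transpose (v t) ** \<gamma> t = - A" for t
    using arg_cong [OF gv [of t], of transpose] by (simp add: matrix_transpose_mul At)
  have vv: "transpose (v t) ** v t = - (A ** A) + transpose (e t) ** transpose B ** B ** e t" for t
  proof -
    have "transpose (v t) ** v t = (transpose (v t) ** \<gamma> t) ** A + (transpose (v t) ** \<gamma>p t) ** (B ** e t)"
      by (subst (2) v_def) (simp add: matrix_distribs matrix_mul_assoc)
    moreover have "transpose (v t) ** \<gamma>p t = transpose (e t) ** transpose B ** mat_on J"
      by (simp add: v_def matrix_distribs pg gp pp gp flip: matrix_mul_assoc)
    ultimately show ?thesis
      by (simp add: gv' matrix_distribs cancel BJ flip: matrix_mul_assoc)
  qed
  have acc: "covariant_acceleration stiefel_tangent stiefel_metric \<gamma> t = acc t" for t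
    unfolding stiefel_covariant_acceleration [OF smooth] vel vel2 gv vv
    by (simp add: gg pg At v_def a_def acc_def eA matrix_mul_cancel [OF eA] matrix_distribs scaleR_2 algebra_simps flip: matrix_mul_assoc)
  have norm_v: "stiefel_metric (\<gamma> t) (v t) (v t) = A \<bullet> A / 2 + B \<bullet> B" for t
  proof -
    have "(\<gamma>p t ** (B ** e t)) \<bullet> (\<gamma>p t ** (B ** e t)) = (B ** e t) \<bullet> (B ** e t)"
      by (simp add: inner_matrix_left cancel)
    also have "\<dots> = B \<bullet> B" by (rule inner_matrix_right [OF ee(2)])
    finally have 1: "(\<gamma>p t ** (B ** e t)) \<bullet> (\<gamma>p t ** (B ** e t)) = B \<bullet> B" .
    have 2: "(\<gamma> t ** A) \<bullet> (\<gamma> t ** A) = A \<bullet> A" "(\<gamma> t ** A) \<bullet> (\<gamma>p t ** (B ** e t)) = 0"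
      by (simp_all add: inner_matrix_left cancel matrix_distribs)
    have "v t \<bullet> v t = A \<bullet> A + B \<bullet> B"
      using 1 2 by (simp add: v_def inner_add_left inner_add_right inner_commute flip: matrix_mul_assoc)
    then show ?thesis by (simp add: stiefel_metric_inner gv)
  qed
  have norm_acc: "stiefel_metric (\<gamma> t) (acc t) (acc t) = (norm (B ** A))\<^sup>2" for t
  proof -
    have "transpose (\<gamma> t) ** acc t = 0"
      by (simp add: acc_def cancel matrix_distribs flip: matrix_mul_assoc)
    moreover have "acc t \<bullet> acc t = (B ** A ** e t) \<bullet> (B ** A ** e t)"
      by (simp add: acc_def inner_matrix_left cancel flip: matrix_mul_assoc)
    moreover have "\<dots> = (B ** A) \<bullet> (B ** A)" by (rule inner_matrix_right [OF ee(2)])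
    ultimately show ?thesis by (simp add: stiefel_metric_inner power2_norm_eq_inner)
  qed
  have "is_quasi_geodesic stiefel stiefel_tangent stiefel_metric \<gamma>"
    using smooth by (auto simp: is_quasi_geodesic_def metric_norm_def vel acc norm_v norm_acc)
  moreover have "\<gamma> t = (U ** V ** diag_map cos (t *\<^sub>R S) + Q ** diag_map sin (t *\<^sub>R S))
                    ** transpose V ** mat_exp (t *\<^sub>R A)" for t
    using mat_exp_stiefel_rot_svd [OF U assms(7), of t] by (simp add: \<gamma> E_def R_def e_def)
  moreover have "\<gamma> 0 = U" by (simp add: \<gamma> E_def e_def mat_exp_0)
  moreover have "(metric_norm stiefel_metric (\<gamma> t) (v t))\<^sup>2
                = 1/2 * trace (transpose A ** A) + trace (transpose B ** B)" for t
    by (simp add: metric_norm_def norm_v flip: inner_trace)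
  moreover have "(metric_norm stiefel_metric (\<gamma> t) (acc t))\<^sup>2 = (norm (B ** A))\<^sup>2" for t
    by (simp add: metric_norm_def norm_acc)
  moreover have "is_geodesic stiefel stiefel_tangent stiefel_metric \<gamma> \<longleftrightarrow> B ** A = 0"
  proof
    assume "is_geodesic stiefel stiefel_tangent stiefel_metric \<gamma>"
    then have "acc 0 = 0" by (simp add: is_geodesic_def acc)
    then have "(norm (B ** A))\<^sup>2 = 0"
      using norm_acc [of 0] by (simp add: stiefel_metric_inner matrix_distribs)
    then show "B ** A = 0" by simp
  next
    assume "B ** A = 0"
    then have "acc t = 0" for t by (simp add: acc_def matrix_distribs matrix_mul_cancel flip: matrix_mul_assoc)
    then show "is_geodesic stiefel stiefel_tangent stiefel_metric \<gamma>"
      by (simp add: is_geodesic_def smooth acc)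
  qed
  moreover have "transpose (e t) = mat_exp (t *\<^sub>R transpose A)" for t
    by (simp add: e_def transpose_scaleR flip: mat_exp_transpose)
  ultimately show ?thesis
    unfolding Let_def \<gamma>_def [symmetric] \<gamma>p_def [symmetric] vel
    using is_retraction_stiefel_RS orth dg dv acc
    by (simp add: v_def a_def acc_def e_def)
qed

end
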